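(* Let $X$ be a Banach space and let $F:[0,\infty)\to X$ be locally Hölder-continuous with $F(0)=0$ and with exponential growth bound $\omega_0\in\mathbb{R}$. Then for any $\omega>\omega_0$, $$F(t)=\lim_{R\to\infty}\frac{1}{2\pi i}\int_{\omega-iR}^{\omega+iR}e^{\lambda t}\,\mathcal{L}(F)(\lambda)\,d\lambda\quad\text{locally uniformly in } t\in[0,\infty).$$
   Context: $X$ is a Banach space with complex scalars and norm $\|\cdot\|$. A function $F:[0,\infty)\to X$ is locally Hölder-continuous if for every compact $K\subset[0,\infty)$ there exist $\alpha_0=\alpha_0(K)\in(0,1]$ and $C=C(K)>0$ with $\|F(x)-F(y)\|\le C|x-y|^{\alpha_0}$ for all $x,y\in K$. $F$ has exponential growth bound $\omega_0\in\mathbb{R}$ if there exists $C>0$ such that $\|F(t)\|\le Ce^{\omega_0t}$ for all $t\ge0$. The Laplace transform of such $F$ is $\mathcal{L}(F)(\lambda)=\int_0^\infty e^{-\lambda s}F(s)\,ds$ for $\mathrm{Re}(\lambda)>\omega_0$ (Bochner integral). The integral from $\omega-iR$ to $\omega+iR$ is along the vertical segment. Locally uniformly in $t\in[0,\infty)$ means uniformly on every compact subset of $[0,\infty)$, with convergence in the norm of $X$. *)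

theory Defs
  imports "HOL-Analysis.Analysis"
begin

text \<open>Complex Banach spaces. The law \<open>scaleC 1 x = x\<close> follows from \<open>scaleC_of_real\<close>.\<close>

class complex_banach = banach +
  fixes scaleC :: "complex \<Rightarrow> 'a \<Rightarrow> 'a" (infixr \<open>*\<^sub>C\<close> 75)
  assumes scaleC_add_right: "a *\<^sub>C (x + y) = a *\<^sub>C x + a *\<^sub>C y"
    and scaleC_add_left: "(a + b) *\<^sub>C x = a *\<^sub>C x + b *\<^sub>C x"
    and scaleC_scaleC: "a *\<^sub>C b *\<^sub>C x = (a * b) *\<^sub>C x"
    and scaleC_of_real: "complex_of_real r *\<^sub>C x = r *\<^sub>R x"
    and norm_scaleC: "norm (a *\<^sub>C x) = cmod a * norm x"

instantiation complex :: complex_banach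
begin

definition scaleC_complex :: "complex \<Rightarrow> complex \<Rightarrow> complex" where
  "scaleC_complex a x = a * x"

instance
  by standard
    (simp_all add: scaleC_complex_def algebra_simps norm_mult scaleR_conv_of_real)

end

text \<open>
  The Bochner integral in Banach spaces that need not be separable. This is
  \<open>has_bochner_integral\<close> of \<open>HOL-Analysis.Bochner_Integration\<close> without its sort
  constraint \<open>second_countable_topology\<close>. For Borel \<open>f\<close> and simple \<open>s i\<close> the functions
  \<open>\<lambda>x. norm (f x - s i x)\<close> are still measurable, since \<open>s i\<close> takes only finitely many
  values; approximability in mean then gives almost everywhere separable range, i.e.
  strong measurability of \<open>f\<close>.
\<close>

definition has_bochner_integral_ns ::
    "'b measure \<Rightarrow> ('b \<Rightarrow> 'a::banach) \<Rightarrow> 'a \<Rightarrow> bool" where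
  "has_bochner_integral_ns M f I \<longleftrightarrow>
     f \<in> borel_measurable M \<and>
     (\<exists>s. (\<forall>i. Bochner_Integration.simple_bochner_integrable M (s i)) \<and>
          (\<lambda>i. \<integral>\<^sup>+x. ennreal (norm (f x - s i x)) \<partial>M) \<longlonglongrightarrow> 0 \<and>
          (\<lambda>i. Bochner_Integration.simple_bochner_integral M (s i)) \<longlonglongrightarrow> I)"

definition bochner_integral_ns :: "'b measure \<Rightarrow> ('b \<Rightarrow> 'a::banach) \<Rightarrow> 'a" where
  "bochner_integral_ns M f =
     (if \<exists>I. has_bochner_integral_ns M f I then THE I. has_bochner_integral_ns M f I else 0)"

text \<open>
  Functions on \<open>[0,\<infinity>)\<close> are represented by functions on \<open>real\<close>, of which only the
  values on \<open>{0..}\<close> are used.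
\<close>

definition locally_hoelder :: "(real \<Rightarrow> 'a::real_normed_vector) \<Rightarrow> bool" where
  "locally_hoelder F \<longleftrightarrow>
     (\<forall>K. compact K \<and> K \<subseteq> {0..} \<longrightarrow>
        (\<exists>\<alpha> C. 0 < \<alpha> \<and> \<alpha> \<le> 1 \<and> C > 0 \<and>
           (\<forall>x\<in>K. \<forall>y\<in>K. norm (F x - F y) \<le> C * \<bar>x - y\<bar> powr \<alpha>)))"

definition exponential_growth_bound ::
    "(real \<Rightarrow> 'a::real_normed_vector) \<Rightarrow> real \<Rightarrow> bool" where
  "exponential_growth_bound F \<omega>\<^sub>0 \<longleftrightarrow>
     (\<exists>C>0. \<forall>t\<ge>0. norm (F t) \<le> C * exp (\<omega>\<^sub>0 * t))"

definition laplace_transform :: "(real \<Rightarrow> 'a::complex_banach) \<Rightarrow> complex \<Rightarrow> 'a" where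
  "laplace_transform F z =
     bochner_integral_ns (lebesgue_on {0..}) (\<lambda>s. exp (- z * complex_of_real s) *\<^sub>C F s)"

text \<open>
  Vector-valued analogue of \<open>contour_integral (linepath a b)\<close>; the factor \<open>b - a\<close> is the
  derivative of \<open>linepath a b\<close>.
\<close>

definition segment_integral ::
    "complex \<Rightarrow> complex \<Rightarrow> (complex \<Rightarrow> 'a::complex_banach) \<Rightarrow> 'a" where
  "segment_integral a b G = integral {0..1} (\<lambda>x. (b - a) *\<^sub>C G (linepath a b x))"

end

theory Submission
  imports Defs "HOL-Probability.Sinc_Integral" "HOL-Real_Asymp.Real_Asymp"
begin

text \<open>
  Put \<open>G s = exp (- \<omega> * s) *\<^sub>R F s\<close>, which decays exponentially because \<open>\<omega> > \<omega>\<^sub>0\<close>.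
  Inserting the Laplace integral into the inversion integral and exchanging the order of
  integration turns the inner integral over the segment into a Dirichlet kernel, so that
  the inversion integral equals \<open>exp (\<omega> * t)\<close> times
  the integral of \<open>sin (R * (t - s)) / (\<pi> * (t - s)) *\<^sub>R G s\<close> over \<open>s \<ge> 0\<close>.
  The claim is therefore a uniform version of Dini's criterion for Fourier integrals.
  Fold the line at \<open>t\<close>, so that only integrals of \<open>sin (R * u) / u\<close> against
  \<open>G (t - u)\<close> and \<open>G (t + u)\<close> over \<open>u \<ge> 0\<close> remain; since \<open>G 0 = 0\<close>, extending \<open>G\<close> by \<open>0\<close>
  to the negative axis keeps it Hoelder continuous, also at \<open>t = 0\<close>. Each half tends
  to \<open>(\<pi> / 2) G t\<close>, uniformly in \<open>t\<close>:

  \<^item> on \<open>u \<le> \<delta>\<close> the Hoelder bound makes the contribution of \<open>G (t \<plusminus> u) - G t\<close> at most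
    \<open>L \<integral> u powr (\<alpha> - 1)\<close>, which is small independently of \<open>R\<close>;
  \<^item> the constant \<open>G t\<close> contributes the sine integral \<open>Si (R * \<delta>)\<close>, which tends to \<open>\<pi> / 2\<close>;
  \<^item> on \<open>\<delta> \<le> u \<le> T0\<close> the Riemann--Lebesgue lemma applies, uniformly in \<open>t\<close> since
    \<open>(t, u) \<mapsto> G (t \<plusminus> u) / u\<close> is uniformly continuous on a compact set;
  \<^item> on \<open>u \<ge> T0\<close> the exponential decay gives a bound that is independent of \<open>R\<close>.

  This is \<open>dirichlet_one_sided_uniform\<close>, and \<open>dirichlet_two_sided_uniform\<close> after folding.

  The Bochner integral only has to be compared with gauge integrals over compact intervals:
  for a continuous function with exponential decay the two agree in the limit
  (\<open>has_bochner_integral_ns_exp_decay\<close>), with an explicit truncation error. This error is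
  uniform along a vertical line, so the exchange of integrals
  (\<open>inversion_integral_eq_dirichlet_limit\<close>) takes place on compact rectangles, where
  the integrand is continuous. Apart from the Bochner integrals themselves, this allows all
  arguments to use gauge integrals of continuous functions with values in an arbitrary Banach space.
\<close>

section \<open>Bochner integrals without separability\<close>

text \<open>
  A simple function is a finite combination of indicator functions of its level sets, so the
  comparison with the gauge integral reduces to the measure of these sets.
\<close>

lemma simple_bochner_integral_has_integral:
  fixes s :: "real \<Rightarrow> 'a::banach"
  assumes S: "S \<in> sets lebesgue" and s: "Bochner_Integration.simple_bochner_integrable (lebesgue_on S) s"
  shows "(s has_integral Bochner_Integration.simple_bochner_integral (lebesgue_on S) s) S"
proof -
  define A where "A = (\<lambda>y. {x \<in> S. s x = y})"
  have sf: "simple_function (lebesgue_on S) s"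
    and fin: "emeasure (lebesgue_on S) {x \<in> S. s x \<noteq> 0} \<noteq> \<infinity>"
    using s by (auto elim: simple_bochner_integrable.cases)
  have finS: "finite (s ` S)"
    using simple_functionD(1)[OF sf] by simp
  have level: "((\<lambda>x. indicator (A y) x *\<^sub>R y) has_integral measure (lebesgue_on S) (A y) *\<^sub>R y) S"
    for y
  \<comment> \<open>The level set of \<open>0\<close> may have infinite measure; its term vanishes all the same.\<close>
  proof (cases "y = 0")
    case False
    have "A y = s -` {y} \<inter> space (lebesgue_on S)"
      by (auto simp: A_def)
    then have A: "A y \<in> sets (lebesgue_on S)"
      using simple_functionD(2)[OF sf, of "{y}"] by simp
    then have leb: "A y \<in> sets lebesgue"
      using S by (metis sets.Int_space_eq2 sets_restrict_space_iff space_restrict_space2)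
    have "emeasure (lebesgue_on S) (A y) \<le> emeasure (lebesgue_on S) {x \<in> S. s x \<noteq> 0}"
    proof (rule emeasure_mono)
      show "A y \<subseteq> {x \<in> S. s x \<noteq> 0}" using False by (auto simp: A_def)
      have "{x \<in> S. s x \<noteq> 0} = s -` (- {0}) \<inter> space (lebesgue_on S)" by auto
      then show "{x \<in> S. s x \<noteq> 0} \<in> sets (lebesgue_on S)"
        using simple_functionD(2)[OF sf, of "- {0}"] by simp
    qed
    then have "emeasure (lebesgue_on S) (A y) < \<infinity>"
      using fin by (simp add: order_le_less_trans less_top)
    then have "emeasure lebesgue (A y) < \<infinity>"
      using S by (subst (asm) emeasure_restrict_space) (auto simp: A_def)
    then have "A y \<in> lmeasurable"
      using leb by (simp add: fmeasurable_def)
    then have "(indicator (A y) has_integral measure lebesgue (A y)) UNIV"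
      by (simp add: lmeasurable_iff_has_integral)
    moreover have "(\<lambda>x. if x \<in> S then indicator (A y) x else (0::real)) = indicator (A y)"
      by (auto simp: A_def indicator_def)
    ultimately have "(indicator (A y) has_integral measure lebesgue (A y)) S"
      by (subst has_integral_restrict_UNIV[symmetric]) simp
    moreover have "measure (lebesgue_on S) (A y) = measure lebesgue (A y)"
      using S by (intro measure_restrict_space) (auto simp: A_def)
    ultimately show ?thesis
      by (simp add: has_integral_scaleR_left)
  qed simp
  have "((\<lambda>x. \<Sum>y\<in>s ` S. indicator (A y) x *\<^sub>R y) has_integral
        (\<Sum>y\<in>s ` S. measure (lebesgue_on S) (A y) *\<^sub>R y)) S"
    by (intro has_integral_sum finS level)
  moreover have "(\<Sum>y\<in>s ` S. indicator (A y) x *\<^sub>R y) = s x" if "x \<in> S" for x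
  proof -
    have "(\<Sum>y\<in>s ` S. indicator (A y) x *\<^sub>R y) = (\<Sum>y\<in>s ` S. if y = s x then y else 0)"
      using that by (intro sum.cong) (auto simp: A_def indicator_def)
    then show ?thesis using finS that by simp
  qed
  ultimately have "(s has_integral (\<Sum>y\<in>s ` S. measure (lebesgue_on S) (A y) *\<^sub>R y)) S"
    by (rule has_integral_eq[rotated])
  then show ?thesis
    by (simp add: simple_bochner_integral_def A_def)
qed

text \<open>
  Subtraction need not be Borel measurable on a product of nonseparable spaces.
  Here the second function has finitely many values, and on each of its level sets
  the norm of the difference is a continuous function of \<open>f x\<close>.
\<close>

lemma borel_measurable_norm_diff_simple:
  fixes f :: "'b \<Rightarrow> 'a::real_normed_vector"
  assumes f: "f \<in> borel_measurable M" and s: "simple_function M s"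
  shows "(\<lambda>x. norm (f x - s x)) \<in> borel_measurable M"
proof (rule measurable_compose_countable'[where f = "\<lambda>y x. norm (f x - y)" and I = "s ` space M"])
  show "countable (s ` space M)"
    using simple_functionD(1)[OF s] by (rule countable_finite)
  show "s \<in> measurable M (count_space (s ` space M))"
    using simple_functionD(2)[OF s] by (simp add: measurable_def)
  show "(\<lambda>x. norm (f x - y)) \<in> borel_measurable M" for y
  proof -
    have "(\<lambda>v. norm (v - y)) \<in> borel_measurable borel"
      by (intro borel_measurable_continuous_onI continuous_intros)
    from measurable_compose[OF f this] show ?thesis .
  qed
qed

text \<open>
  Two approximating sequences have mean distance tending to \<open>0\<close>, and this distance bounds
  the distance of their integrals.
\<close>

lemma has_bochner_integral_ns_unique:
  assumes "has_bochner_integral_ns M f I" and "has_bochner_integral_ns M f J"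
  shows "I = J"
proof -
  from assms(1) obtain s where f: "f \<in> borel_measurable M"
    and s: "\<And>i. Bochner_Integration.simple_bochner_integrable M (s i)"
      "(\<lambda>i. \<integral>\<^sup>+x. ennreal (norm (f x - s i x)) \<partial>M) \<longlonglongrightarrow> 0"
      "(\<lambda>i. Bochner_Integration.simple_bochner_integral M (s i)) \<longlonglongrightarrow> I"
    unfolding has_bochner_integral_ns_def by blast
  from assms(2) obtain t where
    t: "\<And>i. Bochner_Integration.simple_bochner_integrable M (t i)"
      "(\<lambda>i. \<integral>\<^sup>+x. ennreal (norm (f x - t i x)) \<partial>M) \<longlonglongrightarrow> 0"
      "(\<lambda>i. Bochner_Integration.simple_bochner_integral M (t i)) \<longlonglongrightarrow> J"
    unfolding has_bochner_integral_ns_def by blast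
  have sf: "simple_function M (s i)" "simple_function M (t i)" for i
    using s(1)[of i] t(1)[of i] by (auto elim: simple_bochner_integrable.cases)
  note [measurable] = borel_measurable_norm_diff_simple[OF f sf(1)]
    borel_measurable_norm_diff_simple[OF f sf(2)]
  have bound: "ennreal (norm (Bochner_Integration.simple_bochner_integral M (s i) - Bochner_Integration.simple_bochner_integral M (t i)))
      \<le> (\<integral>\<^sup>+x. ennreal (norm (f x - s i x)) \<partial>M) + (\<integral>\<^sup>+x. ennreal (norm (f x - t i x)) \<partial>M)" for i
  proof -
    have "norm (Bochner_Integration.simple_bochner_integral M (s i) - Bochner_Integration.simple_bochner_integral M (t i))
        = norm (Bochner_Integration.simple_bochner_integral M (\<lambda>x. s i x - t i x))"
      using s(1) t(1) by (subst simple_bochner_integral_diff) auto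
    also have "\<dots> \<le> Bochner_Integration.simple_bochner_integral M (\<lambda>x. norm (s i x - t i x))"
      using simple_bochner_integrable_compose2[of "(-)" M "s i" "t i"] s(1) t(1)
      by (auto intro!: simple_bochner_integral_norm_bound)
    also have "ennreal (Bochner_Integration.simple_bochner_integral M (\<lambda>x. norm (s i x - t i x)))
        = (\<integral>\<^sup>+x. ennreal (norm (s i x - t i x)) \<partial>M)"
      using simple_bochner_integrable_compose2[of "\<lambda>x y. norm (x - y)" M "s i" "t i"] s(1) t(1)
      by (auto intro!: simple_bochner_integral_eq_nn_integral)
    also have "\<dots> \<le> (\<integral>\<^sup>+x. ennreal (norm (f x - s i x)) + ennreal (norm (f x - t i x)) \<partial>M)"
    proof (rule nn_integral_mono)
      fix x
      have "norm (s i x - t i x) \<le> norm (f x - s i x) + norm (f x - t i x)"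
        by (metis dual_order.refl norm_diff_triangle_le norm_minus_commute)
      then show "ennreal (norm (s i x - t i x))
          \<le> ennreal (norm (f x - s i x)) + ennreal (norm (f x - t i x))"
        by (metis ennreal_leI ennreal_plus norm_ge_zero)
    qed
    also have "\<dots> = (\<integral>\<^sup>+x. ennreal (norm (f x - s i x)) \<partial>M) + (\<integral>\<^sup>+x. ennreal (norm (f x - t i x)) \<partial>M)"
      by (rule nn_integral_add) auto
    finally show ?thesis by (simp add: ennreal_leI)
  qed
  have lim: "(\<lambda>i. (\<integral>\<^sup>+x. ennreal (norm (f x - s i x)) \<partial>M)
      + (\<integral>\<^sup>+x. ennreal (norm (f x - t i x)) \<partial>M)) \<longlonglongrightarrow> 0"
    using tendsto_add[OF s(2) t(2)] by simp
  have "(\<lambda>i. ennreal (norm (Bochner_Integration.simple_bochner_integral M (s i)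
      - Bochner_Integration.simple_bochner_integral M (t i)))) \<longlonglongrightarrow> ennreal 0"
    unfolding ennreal_0
    by (rule tendsto_sandwich[OF _ always_eventually tendsto_const lim]) (use bound in auto)
  then have "(\<lambda>i. norm (Bochner_Integration.simple_bochner_integral M (s i) - Bochner_Integration.simple_bochner_integral M (t i))) \<longlonglongrightarrow> 0"
    by (subst (asm) tendsto_ennreal_iff) auto
  moreover have "(\<lambda>i. norm (Bochner_Integration.simple_bochner_integral M (s i) - Bochner_Integration.simple_bochner_integral M (t i)))
      \<longlonglongrightarrow> norm (I - J)"
    by (intro tendsto_norm tendsto_diff s t)
  ultimately show ?thesis
    using LIMSEQ_unique by fastforce
qed

lemma bochner_integral_ns_eqI:
  "has_bochner_integral_ns M f I \<Longrightarrow> bochner_integral_ns M f = I"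
  unfolding bochner_integral_ns_def
  by (auto intro!: the1_equality intro: has_bochner_integral_ns_unique)

lemma exp_tail_integral_bound:
  fixes g :: "real \<Rightarrow> 'a::banach"
  assumes g: "continuous_on {0..} g" and c: "c > 0"
    and bound: "\<And>x. x \<ge> 0 \<Longrightarrow> norm (g x) \<le> C * exp (- c * x)"
    and ab: "0 \<le> a" "a \<le> b"
  shows "norm (integral {a..b} g) \<le> C / c * exp (- c * a)"
proof -
  have C: "C \<ge> 0"
    using bound[of 0] norm_ge_zero[of "g 0"] by (simp del: norm_ge_zero)
  have "((\<lambda>x. C * exp (- c * x)) has_integral (- C / c * exp (- c * b)) - (- C / c * exp (- c * a))) {a..b}"
    by (rule fundamental_theorem_of_calculus)
      (use ab c in \<open>auto intro!: derivative_eq_intros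
         simp: has_real_derivative_iff_has_vector_derivative[symmetric]\<close>)
  moreover have "g integrable_on {a..b}"
    by (intro integrable_continuous_real continuous_on_subset[OF g]) (use ab in auto)
  ultimately have "norm (integral {a..b} g) \<le> (- C / c * exp (- c * b)) - (- C / c * exp (- c * a))"
    using bound ab by (intro integral_norm_bound_integral[THEN order_trans]) 
      (auto simp: has_integral_iff)
  also have "\<dots> \<le> C / c * exp (- c * a)"
    using C c by simp
  finally show ?thesis .
qed

text \<open>
  The truncated integrals form a Cauchy family; the limit is the candidate for the Bochner
  integral, and the explicit error is what later makes truncation uniform along a vertical line.
\<close>

lemma exp_decay_improper_integral:
  fixes g :: "real \<Rightarrow> 'a::banach"
  assumes g: "continuous_on {0..} g" and c: "c > 0"
    and bound: "\<And>x. x \<ge> 0 \<Longrightarrow> norm (g x) \<le> C * exp (- c * x)"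
  obtains I where "\<And>T. T \<ge> 0 \<Longrightarrow> norm (integral {0..T} g - I) \<le> C / c * exp (- c * T)"
proof -
  have diff: "norm (integral {0..T'} g - integral {0..T} g) \<le> C / c * exp (- c * T)"
    if "0 \<le> T" "T \<le> T'" for T T'
  proof -
    have "g integrable_on {0..T'}"
      by (intro integrable_continuous_real continuous_on_subset[OF g]) auto
    then have "integral {0..T'} g - integral {0..T} g = integral {T..T'} g"
      using Henstock_Kurzweil_Integration.integral_combine[where a = 0 and b = T' and c = T and f = g] that by (simp add: algebra_simps)
    then show ?thesis
      using exp_tail_integral_bound[OF g c bound that] by simp
  qed
  have lim0: "(\<lambda>n. C / c * exp (- c * real n)) \<longlonglongrightarrow> 0"
    using c by real_asymp
  have "Cauchy (\<lambda>n. integral {0..real n} g)"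
  proof (rule CauchyI', unfold dist_norm)
    fix e :: real assume "e > 0"
    with lim0 have "\<forall>\<^sub>F n in sequentially. C / c * exp (- c * real n) < e"
      by (rule order_tendstoD)
    then obtain N where N: "\<And>n. n \<ge> N \<Longrightarrow> C / c * exp (- c * real n) < e"
      by (auto simp: eventually_sequentially)
    show "\<exists>M. \<forall>m\<ge>M. \<forall>n>m. norm (integral {0..real m} g - integral {0..real n} g) < e"
    proof (intro exI[of _ N] allI impI)
      fix m n :: nat assume "N \<le> m" "m < n"
      then have "norm (integral {0..real n} g - integral {0..real m} g) < e"
        by (intro order_le_less_trans[OF diff N]) auto
      then show "norm (integral {0..real m} g - integral {0..real n} g) < e"
        by (simp add: norm_minus_commute)
    qed
  qed
  then obtain I where I: "(\<lambda>n. integral {0..real n} g) \<longlonglongrightarrow> I"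
    using Cauchy_convergent convergent_def by blast
  show thesis
  proof (rule that)
    fix T :: real assume T: "T \<ge> 0"
    have "(\<lambda>n. norm (integral {0..T} g - integral {0..real n} g)) \<longlonglongrightarrow> norm (integral {0..T} g - I)"
      by (intro tendsto_intros I)
    moreover have "\<forall>\<^sub>F n in sequentially. norm (integral {0..T} g - integral {0..real n} g) \<le> C / c * exp (- c * T)"
      using eventually_ge_at_top[of "nat \<lceil>T\<rceil>"]
      by eventually_elim (use diff T in \<open>auto simp: norm_minus_commute nat_ceiling_le_eq\<close>)
    ultimately show "norm (integral {0..T} g - I) \<le> C / c * exp (- c * T)"
      by (rule tendsto_upperbound) simp
  qed
qed

text \<open>
  The approximating simple functions sample \<open>g\<close> at the grid points \<open>\<lfloor>(n + 1) x\<rfloor> / (n + 1)\<close>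
  and vanish beyond \<open>n\<close>. They converge pointwise by continuity and are dominated by a multiple
  of \<open>exp (- c * x)\<close>, as a grid point lies within distance \<open>1\<close> of \<open>x\<close>. Hence their
  distances from \<open>g\<close> converge in mean. This distance also controls the difference
  between the simple integral and the gauge integral of \<open>g\<close> over \<open>{0..n}\<close>, which identifies the limit.
\<close>

lemma has_bochner_integral_ns_exp_decay:
  fixes g :: "real \<Rightarrow> 'a::banach"
  assumes g: "continuous_on {0..} g" and c: "c > 0"
    and bound: "\<And>x. x \<ge> 0 \<Longrightarrow> norm (g x) \<le> C * exp (- c * x)"
    and I: "(\<lambda>n. integral {0..real n} g) \<longlonglongrightarrow> I"
  shows "has_bochner_integral_ns (lebesgue_on {0..}) g I"
proof -
  let ?M = "lebesgue_on {0::real..}"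
  define r where "r = (\<lambda>n x. real_of_int \<lfloor>real (Suc n) * x\<rfloor> / real (Suc n))"
  define s where "s = (\<lambda>n x. if x \<le> real n then g (r n x) else 0)"
  define d where "d = (\<lambda>n x. norm (g x - s n x))"
  have C: "C \<ge> 0"
    using bound[of 0] norm_ge_zero[of "g 0"] by (simp del: norm_ge_zero)
  have S: "{0::real..} \<in> sets lebesgue" by simp
  have r_nonneg: "r n x \<ge> 0" if "x \<ge> 0" for n x
    using that by (simp add: r_def)
  have r_le: "r n x \<le> x" and r_ge: "x - 1 / real (Suc n) \<le> r n x" for n x
  proof -
    have "real_of_int \<lfloor>real (Suc n) * x\<rfloor> \<le> real (Suc n) * x" by (rule of_int_floor_le)
    then show "r n x \<le> x" unfolding r_def by (simp add: pos_divide_le_eq mult.commute del: of_nat_Suc)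
    have "real (Suc n) * x - 1 \<le> real_of_int \<lfloor>real (Suc n) * x\<rfloor>" by linarith
    then have "(real (Suc n) * x - 1) / real (Suc n) \<le> r n x"
      unfolding r_def by (intro divide_right_mono) auto
    then show "x - 1 / real (Suc n) \<le> r n x" by (simp add: diff_divide_distrib del: of_nat_Suc)
  qed
  have r_lim: "(\<lambda>n. r n x) \<longlonglongrightarrow> x" for x
  proof (rule tendsto_sandwich[OF _ _ _ tendsto_const])
    show "(\<lambda>n. x - 1 / real (Suc n)) \<longlonglongrightarrow> x" by real_asymp
    show "\<forall>\<^sub>F n in sequentially. x - 1 / real (Suc n) \<le> r n x"
      by (rule always_eventually) (rule allI, rule r_ge)
    show "\<forall>\<^sub>F n in sequentially. r n x \<le> x"
      by (rule always_eventually) (rule allI, rule r_le)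
  qed

  have sf: "simple_function ?M (s n)" for n
  proof -
    \<comment> \<open>On \<open>{0..}\<close> the floor is nonnegative, so the value \<open>-1\<close> is free to encode the points beyond \<open>n\<close>.\<close>
    define k where "k = (\<lambda>x::real. if x \<le> real n then \<lfloor>real (Suc n) * x\<rfloor> else -1)"
    define h where "h = (\<lambda>j. if j = -1 then 0 else g (real_of_int j / real (Suc n)))"
    have "k \<in> borel \<rightarrow>\<^sub>M count_space UNIV"
      unfolding k_def by measurable
    then have kM: "k \<in> ?M \<rightarrow>\<^sub>M count_space UNIV"
      by (simp add: measurable_completion measurable_restrict_space1)
    have "k ` {0..} \<subseteq> {-1..\<lfloor>real (Suc n) * real n\<rfloor>}"
    proof (rule image_subsetI)
      fix x :: real assume x: "x \<in> {0..}"
      have "\<lfloor>real (Suc n) * x\<rfloor> \<le> \<lfloor>real (Suc n) * real n\<rfloor>" if "x \<le> real n"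
        using that by (intro floor_mono mult_left_mono) auto
      moreover have "0 \<le> \<lfloor>real (Suc n) * x\<rfloor>" "0 \<le> \<lfloor>real (Suc n) * real n\<rfloor>"
        using x by auto
      ultimately show "k x \<in> {-1..\<lfloor>real (Suc n) * real n\<rfloor>}"
        unfolding k_def by (auto simp del: of_nat_Suc intro: order_trans[of _ 0])
    qed
    then have "finite (k ` {0..})" by (rule finite_subset) simp
    then have "simple_function ?M k"
      using measurable_sets[OF kM] by (auto simp: simple_function_def)
    then have "simple_function ?M (h \<circ> k)" by (rule simple_function_compose)
    moreover have "s n x = (h \<circ> k) x" if "x \<in> space ?M" for x
    proof -
      have "\<lfloor>real (Suc n) * x\<rfloor> \<noteq> -1"
        using that zero_le_floor[of "real (Suc n) * x"] by (auto simp del: zero_le_floor of_nat_Suc)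
      then show ?thesis unfolding s_def h_def k_def r_def by (auto simp del: of_nat_Suc)
    qed
    ultimately show ?thesis by (subst simple_function_cong) 
  qed
  have sb: "Bochner_Integration.simple_bochner_integrable ?M (s n)" for n
  proof
    have "emeasure ?M {x \<in> space ?M. s n x \<noteq> 0} \<le> emeasure ?M {0..real n}"
      by (intro emeasure_mono) (auto simp: s_def sets_restrict_space_iff split: if_splits)
    also have "\<dots> = emeasure lebesgue {0..real n}"
      by (intro emeasure_restrict_space) auto
    also have "\<dots> < \<infinity>" by simp
    finally show "emeasure ?M {x \<in> space ?M. s n x \<noteq> 0} \<noteq> \<infinity>" by simp
  qed (rule sf)

  have gM: "g \<in> borel_measurable ?M"
    by (rule continuous_imp_measurable_on_sets_lebesgue[OF g S])
  have dM: "d n \<in> borel_measurable ?M" for n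
    unfolding d_def by (rule borel_measurable_norm_diff_simple[OF gM sf])
  \<comment> \<open>The factor \<open>exp c\<close> pays for evaluating the decay bound at a grid point, up to \<open>1\<close> to the left of \<open>x\<close>.\<close>
  define D where "D = C + C * exp c"
  have d_le: "d n x \<le> D * exp (- c * x)" if x: "x \<ge> 0" for n x
  proof -
    have "norm (s n x) \<le> C * exp c * exp (- c * x)"
    proof (cases "x \<le> real n")
      case True
      have "norm (s n x) \<le> C * exp (- c * r n x)"
        using bound[OF r_nonneg[OF x]] True by (simp add: s_def)
      also have "x - 1 \<le> r n x"
      proof -
        have "1 / real (Suc n) \<le> 1" by simp
        then show ?thesis using r_ge[of x n] by linarith
      qed
      then have "C * exp (- c * r n x) \<le> C * exp (c + - c * x)"
        using C c mult_left_mono[of "x - 1" "r n x" c]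
        by (intro mult_left_mono) (auto simp: algebra_simps)
      also have "\<dots> = C * exp c * exp (- c * x)" by (simp only: exp_add mult.assoc)
      finally show ?thesis .
    qed (use C in \<open>simp add: s_def\<close>)
    then have "d n x \<le> C * exp (- c * x) + C * exp c * exp (- c * x)"
      unfolding d_def using bound[OF x] norm_triangle_ineq4[of "g x" "s n x"] by linarith
    then show ?thesis by (simp add: D_def algebra_simps)
  qed
  have Dint: "(\<lambda>x. D * exp (- c * x)) integrable_on {0..}"
    using has_integral_exp_minus_to_infinity[OF c, of 0]
    by (intro integrable_on_mult_right) (auto simp: has_integral_iff)
  have d_int: "d n integrable_on {0..}" for n
    by (rule measurable_bounded_by_integrable_imp_integrable[OF dM Dint _ S])
       (use d_le in \<open>auto simp: d_def\<close>)
  have d_lim: "(\<lambda>n. d n x) \<longlonglongrightarrow> 0" if x: "x \<in> {0..}" for x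
  proof -
    have "(\<lambda>n. g (r n x)) \<longlonglongrightarrow> g x"
      by (rule continuous_on_tendsto_compose[OF g r_lim])
        (use x r_nonneg in \<open>auto intro: always_eventually\<close>)
    then have "(\<lambda>n. norm (g x - g (r n x))) \<longlonglongrightarrow> 0"
      by (auto intro!: tendsto_eq_intros)
    moreover have "\<forall>\<^sub>F n in sequentially. norm (g x - g (r n x)) = d n x"
      using eventually_ge_at_top[of "nat \<lceil>x\<rceil>"]
      by eventually_elim (auto simp: d_def s_def nat_ceiling_le_eq)
    ultimately show ?thesis by (rule Lim_transform_eventually)
  qed
  have e_lim: "(\<lambda>n. integral {0..} (d n)) \<longlonglongrightarrow> 0"
    using dominated_convergence(2)[of d "{0..}" "\<lambda>x. D * exp (- c * x)" "\<lambda>x. 0", OF d_int Dint _ d_lim] d_le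
    by (simp add: d_def)
  have nn: "(\<integral>\<^sup>+x. ennreal (norm (g x - s n x)) \<partial>?M) = ennreal (integral {0..} (d n))" for n
  proof -
    have "(\<integral>\<^sup>+x. ennreal (norm (g x - s n x)) \<partial>?M)
        = (\<integral>\<^sup>+x. ennreal (d n x) * indicator {0..} x \<partial>lborel)"
      by (simp add: nn_integral_restrict_space nn_integral_completion d_def)
    also have "\<dots> = ennreal (integral {0..} (d n))"
      by (rule nn_integral_has_integral_lebesgue') (auto simp: d_def intro!: integrable_integral d_int[unfolded d_def])
    finally show ?thesis .
  qed
  have "norm (integral {0..real n} g - Bochner_Integration.simple_bochner_integral ?M (s n)) \<le> integral {0..} (d n)" for n
  proof -
    have "(g has_integral integral {0..real n} g) {0..real n}"
      by (intro integrable_integral integrable_continuous_real continuous_on_subset[OF g]) auto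
    then have "((\<lambda>x. if x \<in> {0..real n} then g x else 0) has_integral integral {0..real n} g) {0..}"
      by (subst has_integral_restrict) auto
    then have "((\<lambda>x. (if x \<in> {0..real n} then g x else 0) - s n x) has_integral
        integral {0..real n} g - Bochner_Integration.simple_bochner_integral ?M (s n)) {0..}"
      by (intro has_integral_diff simple_bochner_integral_has_integral[OF S sb])
    then show ?thesis
      using integral_norm_bound_integral[OF _ d_int[of n], of "\<lambda>x. (if x \<in> {0..real n} then g x else 0) - s n x"]
      by (auto simp: has_integral_iff d_def s_def)
  qed
  then have "(\<lambda>n. integral {0..real n} g - Bochner_Integration.simple_bochner_integral ?M (s n)) \<longlonglongrightarrow> 0"
    by (intro Lim_null_comparison[OF _ e_lim]) (auto intro: always_eventually)
  from tendsto_diff[OF I this]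
  have "(\<lambda>n. Bochner_Integration.simple_bochner_integral ?M (s n)) \<longlonglongrightarrow> I" by simp
  moreover have "(\<lambda>n. \<integral>\<^sup>+x. ennreal (norm (g x - s n x)) \<partial>?M) \<longlonglongrightarrow> 0"
    unfolding nn using tendsto_ennrealI[OF e_lim] by simp
  ultimately show ?thesis
    unfolding has_bochner_integral_ns_def using gM sb by blast
qed

section \<open>Oscillatory integrals and the Dirichlet kernel\<close>

text \<open>
  A translation by the half period \<open>\<pi> / R\<close> changes the sign of \<open>sin (R * x)\<close>. Adding the translated
  integral to the original one leaves differences of \<open>h\<close> at distance \<open>\<pi> / R\<close>, and two boundary
  pieces of length \<open>\<pi> / R\<close>. The bound depends on \<open>h\<close> only through its supremum and its modulus of
  continuity, so it is uniform over equicontinuous bounded families.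
\<close>

lemma oscillatory_integral_bound:
  fixes h :: "real \<Rightarrow> 'a::banach"
  assumes h: "continuous_on {a..b} h" and R: "R > 0" and ab: "pi / R \<le> b - a"
    and bound: "\<And>x. x \<in> {a..b} \<Longrightarrow> norm (h x) \<le> B"
    and modulus: "\<And>x. a \<le> x \<Longrightarrow> x + pi / R \<le> b \<Longrightarrow> norm (h (x + pi / R) - h x) \<le> e"
  shows "norm (integral {a..b} (\<lambda>x. sin (R * x) *\<^sub>R h x)) \<le> B * (pi / R) + e * (b - a)"
proof -
  define d where "d = pi / R"
  have d: "d > 0" "a + d \<le> b" "R * d = pi" using R ab by (auto simp: d_def)
  define k where "k = (\<lambda>x. sin (R * x) *\<^sub>R h x)"
  have k: "continuous_on {a..b} k"
    unfolding k_def by (intro continuous_intros h)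
  have k_int: "k integrable_on {u..v}" if "a \<le> u" "v \<le> b" for u v
    by (intro integrable_continuous_real continuous_on_subset[OF k]) (use that in auto)
  have k_le: "norm (k x) \<le> B" if "x \<in> {a..b}" for x
  proof -
    have "norm (k x) = \<bar>sin (R * x)\<bar> * norm (h x)" by (simp add: k_def)
    also have "\<dots> \<le> 1 * norm (h x)" by (intro mult_right_mono) auto
    finally show ?thesis using bound[OF that] by simp
  qed
  have B: "0 \<le> B" using k_le[of a] d norm_ge_zero[of "k a"] by (simp del: norm_ge_zero)
  have e: "0 \<le> e" using modulus[of a] d norm_ge_zero[of "h (a + d) - h a"] 
    by (simp add: d_def del: norm_ge_zero)
  have short: "norm (integral {u..v} k) \<le> B * d" if "a \<le> u" "v \<le> b" "v = u + d" for u v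
    using integral_bound[of u v k B] continuous_on_subset[OF k, of "{u..v}"] k_le that d by auto
  let ?J = "integral {a..b} k"
  have "integral {a..a+d} k + integral {a+d..b} k = ?J"
    using d k_int by (intro Henstock_Kurzweil_Integration.integral_combine) auto
  moreover have "integral {a..b-d} k + integral {b-d..b} k = ?J"
    using d k_int by (intro Henstock_Kurzweil_Integration.integral_combine) auto
  moreover have shift: "integral {a..b-d} (\<lambda>x. k (x + d)) = integral {a+d..b} k"
    using integral_shift_real_ivl[of "a + d" d b k] by simp
  moreover have "integral {a..b-d} (\<lambda>x. k (x + d)) + integral {a..b-d} k
      = integral {a..b-d} (\<lambda>x. k (x + d) + k x)"
  proof (rule integral_add[symmetric])
    show "(\<lambda>x. k (x + d)) integrable_on {a..b-d}"
      using integrable_shift_real_ivl[OF k_int[of "a + d" b], of d] d by simp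
    show "k integrable_on {a..b-d}" using k_int d by simp
  qed
  ultimately have J: "2 *\<^sub>R ?J = integral {a..a+d} k + integral {b-d..b} k
      + integral {a..b-d} (\<lambda>x. k (x + d) + k x)"
    by (simp add: scaleR_2 algebra_simps) (metis add.assoc add.left_commute)
  have "norm (integral {a..b-d} (\<lambda>x. k (x + d) + k x)) \<le> e * ((b - d) - a)"
  proof (rule integral_bound)
    show "continuous_on {a..b - d} (\<lambda>x. k (x + d) + k x)"
      by (intro continuous_intros continuous_on_compose2[OF k] continuous_on_subset[OF k]) (use d in auto)
    fix x assume x: "x \<in> {a..b - d}"
    have "sin (R * (x + d)) = - sin (R * x)"
      using d(3) by (simp add: distrib_left)
    then have "k (x + d) + k x = - sin (R * x) *\<^sub>R (h (x + d) - h x)"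
      by (simp add: k_def algebra_simps)
    then have "norm (k (x + d) + k x) = \<bar>sin (R * x)\<bar> * norm (h (x + d) - h x)" by simp
    also have "\<dots> \<le> 1 * norm (h (x + d) - h x)" by (intro mult_right_mono) auto
    also have "\<dots> \<le> e" using modulus[of x] x by (simp add: d_def)
    finally show "norm (k (x + d) + k x) \<le> e" .
  qed (use d in simp)
  also have "\<dots> \<le> e * (2 * (b - a))" using e d by (intro mult_left_mono) auto
  finally have "norm (2 *\<^sub>R ?J) \<le> B * d + B * d + e * (2 * (b - a))"
    unfolding J using d by (intro norm_triangle_mono short) auto
  then have "norm ?J \<le> B * d + e * (b - a)" by (simp add: algebra_simps)
  then show ?thesis by (simp add: k_def d_def)
qed

text \<open>
  By compactness of the product the whole family has one bound and one modulus of continuity.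
\<close>

lemma riemann_lebesgue_uniform:
  fixes H :: "real \<Rightarrow> real \<Rightarrow> 'a::banach"
  assumes K: "compact K" and ab: "a < b"
    and H: "continuous_on (K \<times> {a..b}) (\<lambda>(t, x). H t x)" and e: "e > 0"
  shows "\<forall>\<^sub>F R in at_top. \<forall>t\<in>K. norm (integral {a..b} (\<lambda>x. sin (R * x) *\<^sub>R H t x)) \<le> e"
proof -
  let ?S = "K \<times> {a..b}"
  have S: "compact ?S" by (intro compact_Times K) simp
  have "compact ((\<lambda>(t, x). H t x) ` ?S)" by (rule compact_continuous_image[OF H S])
  then obtain B where "B > 0" and B0: "\<forall>y\<in>(\<lambda>(t, x). H t x) ` ?S. norm y \<le> B"
    using compact_imp_bounded bounded_pos by meson
  have B: "norm (H t x) \<le> B" if "t \<in> K" "x \<in> {a..b}" for t x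
    using bspec[OF B0, of "H t x"] that by force
  define e' where "e' = e / (2 * (b - a))"
  have e': "e' > 0" using e ab by (simp add: e'_def)
  obtain \<delta> where \<delta>: "\<delta> > 0" and uc0: "\<forall>p\<in>?S. \<forall>q\<in>?S. dist q p < \<delta> \<longrightarrow>
      dist (case q of (t, x) \<Rightarrow> H t x) (case p of (t, x) \<Rightarrow> H t x) < e'"
    using compact_uniformly_continuous[OF H S] e' unfolding uniformly_continuous_on_def by meson
  have uc: "dist (H t x') (H t x) < e'"
    if "t \<in> K" "x \<in> {a..b}" "x' \<in> {a..b}" "dist x' x < \<delta>" for t x x'
    using uc0[rule_format, of "(t, x)" "(t, x')"] that by (simp add: dist_Pair_Pair)
  have "((\<lambda>R. B * (pi / R)) \<longlongrightarrow> 0) at_top" by real_asymp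
  then have ev1: "\<forall>\<^sub>F R in at_top. B * (pi / R) < e / 2" using e by (intro order_tendstoD) auto
  have lim: "((\<lambda>R. pi / R) \<longlongrightarrow> 0) at_top" by real_asymp
  then have ev2: "\<forall>\<^sub>F R in at_top. pi / R < \<delta>" using \<delta> by (intro order_tendstoD)
  have ev3: "\<forall>\<^sub>F R in at_top. pi / R < b - a" using lim ab by (intro order_tendstoD) auto
  show ?thesis
    using ev1 ev2 ev3 eventually_gt_at_top[of 0]
  proof eventually_elim
    case (elim R)
    show ?case
    proof
      fix t assume t: "t \<in> K"
      have cont: "continuous_on {a..b} (H t)"
      proof -
        have "continuous_on {a..b} (\<lambda>x. case (t, x) of (t, x) \<Rightarrow> H t x)"
          by (rule continuous_on_compose2[OF H]) (use t in \<open>auto intro!: continuous_intros\<close>)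
        then show ?thesis by simp
      qed
      have "norm (integral {a..b} (\<lambda>x. sin (R * x) *\<^sub>R H t x)) \<le> B * (pi / R) + e' * (b - a)"
      proof (rule oscillatory_integral_bound[OF cont])
        fix x assume x: "a \<le> x" "x + pi / R \<le> b"
        have "dist (H t (x + pi / R)) (H t x) < e'"
          using x elim t by (intro uc) (auto simp: dist_real_def add_increasing2 intro: order_trans[of _ "x + pi / R"])
        then show "norm (H t (x + pi / R) - H t x) \<le> e'" by (simp add: dist_norm)
      qed (use elim B \<open>B > 0\<close> t in auto)
      also have "e' * (b - a) = e / 2" using ab by (simp add: e'_def field_simps)
      also have "B * (pi / R) + e / 2 \<le> e / 2 + e / 2" using elim(1) by linarith
      finally show "norm (integral {a..b} (\<lambda>x. sin (R * x) *\<^sub>R H t x)) \<le> e" by simp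
    qed
  qed
qed

text \<open>
  The kernel \<open>sin (R * x) / x\<close> is used in the form \<open>R * sinc (R * x)\<close>, which is continuous
  at \<open>0\<close>; all integrands below are then continuous.
\<close>

lemma scaled_sinc_eq: "x \<noteq> 0 \<Longrightarrow> R * sinc (R * x) = sin (R * x) / x" 
  by auto

lemma abs_scaled_sinc_le:
  assumes "x > 0" shows "\<bar>R * sinc (R * x)\<bar> \<le> 1 / x"
  using assms by (auto simp: scaled_sinc_eq divide_right_mono simp del: mult_eq_0_iff)

lemma has_integral_scaled_sinc:
  assumes "0 \<le> b"
  shows "((\<lambda>x. R * sinc (R * x)) has_integral Si (R * b)) {0..b}"
proof -
  have "((\<lambda>x. R * sinc (R * x)) has_integral Si (R * b) - Si (R * 0)) {0..b}"
  proof (rule fundamental_theorem_of_calculus[OF assms])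
    fix x
    have "((\<lambda>x. Si (R * x)) has_real_derivative sinc (R * x) * R) (at x within {0..b})"
      by (rule DERIV_chain'[OF _ DERIV_Si]) (auto intro!: derivative_eq_intros)
    then show "((\<lambda>x. Si (R * x)) has_vector_derivative R * sinc (R * x)) (at x within {0..b})"
      by (simp only: has_real_derivative_iff_has_vector_derivative mult.commute)
  qed
  moreover have "Si 0 = 0" by (simp add: Si_def zero_ereal_def)
  ultimately show ?thesis by simp
qed

text \<open>
  The Dini test in the form needed here. The lower bound \<open>T0\<close> on the upper limit of integration
  does not depend on \<open>R\<close>; it can therefore be combined with the limit \<open>T \<rightarrow> \<infinity>\<close> for fixed \<open>R\<close>.
\<close>

lemma dirichlet_one_sided_uniform:
  fixes H :: "real \<Rightarrow> real \<Rightarrow> 'a::banach"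
  assumes K: "compact K" and H: "continuous_on (K \<times> {0..}) (\<lambda>(t, x). H t x)"
    and hoelder: "\<And>t x. t \<in> K \<Longrightarrow> 0 \<le> x \<Longrightarrow> x \<le> 1 \<Longrightarrow> norm (H t x - H t 0) \<le> L * x powr \<alpha>"
    and \<alpha>: "\<alpha> > 0"
    and decay: "\<And>t x. t \<in> K \<Longrightarrow> 0 \<le> x \<Longrightarrow> norm (H t x) \<le> C * exp (- c * x)" and c: "c > 0"
    and e: "e > 0"
  shows "\<exists>T0. \<forall>\<^sub>F R in at_top. \<forall>t\<in>K. \<forall>T\<ge>T0.
      norm (integral {0..T} (\<lambda>x. (R * sinc (R * x)) *\<^sub>R H t x) - (pi / 2) *\<^sub>R H t 0) \<le> e"
proof -
  \<comment> \<open>The error \<open>e\<close> is divided into four equal parts: near \<open>0\<close>, the sine integral, the middle range and the tail.\<close>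
  define L' where "L' = max L 1"
  define C' where "C' = max C 1"
  have L': "L' > 0" and C': "C' > 0" by (auto simp: L'_def C'_def)
  have hoelder': "norm (H t x - H t 0) \<le> L' * x powr \<alpha>" if "t \<in> K" "0 \<le> x" "x \<le> 1" for t x
    by (rule order_trans[OF hoelder[OF that]]) (simp add: L'_def mult_right_mono)
  have decay': "norm (H t x) \<le> C' * exp (- c * x)" if "t \<in> K" "0 \<le> x" for t x
    by (rule order_trans[OF decay[OF that]]) (simp add: C'_def)
  have H_cont: "continuous_on {0..} (H t)" if t: "t \<in> K" for t
  proof -
    have "continuous_on {0..} (\<lambda>x. case (t, x) of (t, x) \<Rightarrow> H t x)"
      by (rule continuous_on_compose2[OF H]) (use t in \<open>auto intro!: continuous_intros\<close>)
    then show ?thesis by simp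
  qed

  have "((\<lambda>\<delta>. L' * (\<delta> powr \<alpha> / \<alpha>)) \<longlongrightarrow> 0) (at_right 0)"
    using \<alpha> by real_asymp
  then have "\<forall>\<^sub>F \<delta> in at_right 0. L' * (\<delta> powr \<alpha> / \<alpha>) < e / 4"
    using e by (intro order_tendstoD) auto
  moreover have "\<forall>\<^sub>F \<delta> in at_right (0::real). \<delta> \<in> {0<..<1}"
    by (intro eventually_at_right_real) simp
  ultimately have "\<forall>\<^sub>F \<delta> in at_right 0. L' * (\<delta> powr \<alpha> / \<alpha>) < e / 4 \<and> \<delta> \<in> {0<..<1}"
    by (rule eventually_conj)
  then obtain \<delta> where \<delta>: "L' * (\<delta> powr \<alpha> / \<alpha>) < e / 4" "0 < \<delta>" "\<delta> < 1"
    using eventually_happens' trivial_limit_at_right_real by (metis (mono_tags, lifting) greaterThanLessThan_iff)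

  have "((\<lambda>T. C' / c * exp (- c * T)) \<longlongrightarrow> 0) at_top"
    using c by real_asymp
  then have "\<forall>\<^sub>F T in at_top. C' / c * exp (- c * T) < e / 4"
    using e by (intro order_tendstoD) auto
  then have "\<forall>\<^sub>F T in at_top. C' / c * exp (- c * T) < e / 4 \<and> T \<ge> 1"
    using eventually_ge_at_top by (rule eventually_conj)
  then obtain T0 where T0: "C' / c * exp (- c * T0) < e / 4" "T0 \<ge> 1"
    using eventually_happens' trivial_limit_at_top_linorder by (metis (mono_tags, lifting))

  have "\<forall>\<^sub>F R in at_top. \<forall>t\<in>K. norm (integral {\<delta>..T0} (\<lambda>x. sin (R * x) *\<^sub>R ((1 / x) *\<^sub>R H t x))) \<le> e / 4"
  proof (rule riemann_lebesgue_uniform[OF K])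
    show "continuous_on (K \<times> {\<delta>..T0}) (\<lambda>(t, x). (1 / x) *\<^sub>R H t x)"
      unfolding case_prod_unfold
      by (intro continuous_intros continuous_on_subset[OF H[unfolded case_prod_unfold]]) (use \<delta> in auto)
  qed (use \<delta> T0 e in auto)
  moreover have "\<forall>\<^sub>F R in at_top. C' * \<bar>Si (R * \<delta>) - pi / 2\<bar> < e / 4"
  proof -
    have "filterlim (\<lambda>R. R * \<delta>) at_top at_top"
      using \<delta> by real_asymp
    then have "((\<lambda>R. Si (R * \<delta>)) \<longlongrightarrow> pi / 2) at_top"
      by (rule filterlim_compose[OF Si_at_top])
    then have "((\<lambda>R. C' * \<bar>Si (R * \<delta>) - pi / 2\<bar>) \<longlongrightarrow> C' * \<bar>pi / 2 - pi / 2\<bar>) at_top"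
      by (intro tendsto_intros)
    then show ?thesis using e by (intro order_tendstoD) auto
  qed
  ultimately have "\<forall>\<^sub>F R in at_top. \<forall>t\<in>K. \<forall>T\<ge>T0.
      norm (integral {0..T} (\<lambda>x. (R * sinc (R * x)) *\<^sub>R H t x) - (pi / 2) *\<^sub>R H t 0) \<le> e"
  proof eventually_elim
    case (elim R)
    show ?case
    proof (intro ballI allI impI)
      fix t T assume t: "t \<in> K" and T: "T \<ge> T0"
      define k where "k = (\<lambda>x. (R * sinc (R * x)) *\<^sub>R H t x)"
      have sinc_cont: "continuous_on A (\<lambda>x. R * sinc (R * x))" for A
        by (intro continuous_intros)
      have k_cont: "continuous_on {0..} k"
        unfolding k_def by (intro continuous_on_scaleR sinc_cont H_cont t)
      have k_int: "k integrable_on {u..v}" if "0 \<le> u" for u v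
        by (intro integrable_continuous_real continuous_on_subset[OF k_cont]) (use that in auto)
      have "integral {0..\<delta>} k + integral {\<delta>..T} k = integral {0..T} k"
        using \<delta> T T0 by (intro Henstock_Kurzweil_Integration.integral_combine k_int) auto
      moreover have "integral {\<delta>..T0} k + integral {T0..T} k = integral {\<delta>..T} k"
        using \<delta> T T0 by (intro Henstock_Kurzweil_Integration.integral_combine k_int) auto
      moreover have "integral {0..\<delta>} k = integral {0..\<delta>} (\<lambda>x. (R * sinc (R * x)) *\<^sub>R (H t x - H t 0))
          + Si (R * \<delta>) *\<^sub>R H t 0"
      proof -
        have "((\<lambda>x. (R * sinc (R * x)) *\<^sub>R H t 0) has_integral Si (R * \<delta>) *\<^sub>R H t 0) {0..\<delta>}"
          by (intro has_integral_scaleR_left has_integral_scaled_sinc) (use \<delta> in simp)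
        moreover have "(k has_integral integral {0..\<delta>} k) {0..\<delta>}"
          by (intro integrable_integral k_int) simp
        ultimately have "((\<lambda>x. k x - (R * sinc (R * x)) *\<^sub>R H t 0) has_integral
            integral {0..\<delta>} k - Si (R * \<delta>) *\<^sub>R H t 0) {0..\<delta>}"
          by (intro has_integral_diff)
        then have "integral {0..\<delta>} (\<lambda>x. (R * sinc (R * x)) *\<^sub>R (H t x - H t 0)) 
            = integral {0..\<delta>} k - Si (R * \<delta>) *\<^sub>R H t 0"
          unfolding k_def scaleR_diff_right by (rule integral_unique)
        then show ?thesis by simp
      qed
      moreover define N where "N = integral {0..\<delta>} (\<lambda>x. (R * sinc (R * x)) *\<^sub>R (H t x - H t 0))"
      ultimately have split: "integral {0..T} k - (pi / 2) *\<^sub>R H t 0 =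
          N + (Si (R * \<delta>) - pi / 2) *\<^sub>R H t 0 + integral {\<delta>..T0} k + integral {T0..T} k"
        unfolding N_def[symmetric] scaleR_diff_left by (metis (no_types) add.assoc add_diff_eq diff_add_eq)
      have near: "norm N \<le> e / 4"
      proof -
        have pw: "((\<lambda>x. L' * x powr (\<alpha> - 1)) has_integral L' * (\<delta> powr \<alpha> / \<alpha>)) {0..\<delta>}"
          using has_integral_mult_right[OF has_integral_powr_from_0[of "\<alpha> - 1" \<delta>], of L'] \<alpha> \<delta> by simp
        have "norm (integral {0..\<delta>} (\<lambda>x. (R * sinc (R * x)) *\<^sub>R (H t x - H t 0)))
            \<le> integral {0..\<delta>} (\<lambda>x. L' * x powr (\<alpha> - 1))"
        proof (rule integral_norm_bound_integral)
          show "(\<lambda>x. (R * sinc (R * x)) *\<^sub>R (H t x - H t 0)) integrable_on {0..\<delta>}"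
            by (intro integrable_continuous_real continuous_on_scaleR sinc_cont continuous_on_diff
                continuous_on_const continuous_on_subset[OF H_cont[OF t]]) auto
          show "(\<lambda>x. L' * x powr (\<alpha> - 1)) integrable_on {0..\<delta>}"
            using pw by (rule has_integral_integrable)
          fix x assume x: "x \<in> {0..\<delta>}"
          show "norm ((R * sinc (R * x)) *\<^sub>R (H t x - H t 0)) \<le> L' * x powr (\<alpha> - 1)"
          \<comment> \<open>At \<open>x = 0\<close> both sides vanish, as \<open>0 powr (\<alpha> - 1) = 0\<close>.\<close>
          proof (cases "x = 0")
            case False
            then have x0: "x > 0" using x by simp
            have "norm ((R * sinc (R * x)) *\<^sub>R (H t x - H t 0)) \<le> (1 / x) * (L' * x powr \<alpha>)"
              unfolding norm_scaleR
              by (intro mult_mono hoelder'[OF t] abs_scaled_sinc_le) (use x x0 \<delta> in auto)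
            also have "\<dots> = L' * x powr (\<alpha> - 1)" using x0 by (simp add: powr_diff)
            finally show ?thesis .
          qed simp
        qed
        then show ?thesis
          unfolding N_def[symmetric] integral_unique[OF pw] using \<delta>(1) by linarith
      qed
      have "norm (H t 0) \<le> C'" using decay'[OF t, of 0] by simp
      then have jump: "norm ((Si (R * \<delta>) - pi / 2) *\<^sub>R H t 0) \<le> e / 4"
        using elim(2) mult_left_mono[of "norm (H t 0)" C' "\<bar>Si (R * \<delta>) - pi / 2\<bar>"]
        by (simp add: mult.commute)
      have "integral {\<delta>..T0} k = integral {\<delta>..T0} (\<lambda>x. sin (R * x) *\<^sub>R ((1 / x) *\<^sub>R H t x))"
        unfolding k_def using \<delta> by (intro integral_cong) (auto simp: scaled_sinc_eq)
      then have middle: "norm (integral {\<delta>..T0} k) \<le> e / 4"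
        using elim(1) t by simp
      have tail: "norm (integral {T0..T} k) \<le> e / 4"
      proof -
        have "((\<lambda>x. C' * exp (- c * x)) has_integral
            (- C' / c * exp (- c * T)) - (- C' / c * exp (- c * T0))) {T0..T}"
          by (rule fundamental_theorem_of_calculus)
            (use T c in \<open>auto intro!: derivative_eq_intros
               simp: has_real_derivative_iff_has_vector_derivative[symmetric]\<close>)
        moreover have "norm (k x) \<le> C' * exp (- c * x)" if "x \<in> {T0..T}" for x
        proof -
          have x: "x \<ge> 1" using that T0 by simp
          have "norm (k x) \<le> (1 / x) * (C' * exp (- c * x))"
            unfolding k_def norm_scaleR
            by (intro mult_mono decay'[OF t] abs_scaled_sinc_le) (use x in auto)
          also have "\<dots> \<le> 1 * (C' * exp (- c * x))"
            using x C' by (intro mult_right_mono) auto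
          finally show ?thesis by simp
        qed
        moreover have "k integrable_on {T0..T}" using T0 by (intro k_int) simp
        ultimately have "norm (integral {T0..T} k) \<le> (- C' / c * exp (- c * T)) - (- C' / c * exp (- c * T0))"
          by (intro integral_norm_bound_integral[THEN order_trans]) (auto simp: has_integral_iff)
        also have "\<dots> \<le> C' / c * exp (- c * T0)" using c C' by simp
        finally show ?thesis using T0(1) by linarith
      qed
      have "norm (integral {0..T} k - (pi / 2) *\<^sub>R H t 0) \<le> e / 4 + e / 4 + e / 4 + e / 4"
        unfolding split by (intro norm_triangle_mono near jump middle tail)
      then show "norm (integral {0..T} (\<lambda>x. (R * sinc (R * x)) *\<^sub>R H t x) - (pi / 2) *\<^sub>R H t 0) \<le> e"
        by (simp add: k_def)
    qed
  qed
  then show ?thesis by (rule exI)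
qed

section \<open>Locally Hoelder continuous functions\<close>

lemma locally_hoelderE:
  assumes "locally_hoelder F" and "compact K" and "K \<subseteq> {0..}"
  obtains \<alpha> C where "0 < \<alpha>" and "\<alpha> \<le> 1" and "C > 0"
    and "\<And>x y. x \<in> K \<Longrightarrow> y \<in> K \<Longrightarrow> norm (F x - F y) \<le> C * \<bar>x - y\<bar> powr \<alpha>"
proof -
  have "\<exists>\<alpha> C. 0 < \<alpha> \<and> \<alpha> \<le> 1 \<and> C > 0 \<and>
      (\<forall>x\<in>K. \<forall>y\<in>K. norm (F x - F y) \<le> C * \<bar>x - y\<bar> powr \<alpha>)"
    using assms unfolding locally_hoelder_def by blast
  then show thesis using that by blast
qed

lemma locally_hoelder_imp_continuous_on:
  assumes "locally_hoelder F"
  shows "continuous_on {0..} F"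
  unfolding continuous_on_def
proof
  fix x :: real assume x: "x \<in> {0..}"
  obtain \<alpha> C where "0 < \<alpha>"
    and h: "\<And>y z. y \<in> {0..x + 1} \<Longrightarrow> z \<in> {0..x + 1} \<Longrightarrow> norm (F y - F z) \<le> C * \<bar>y - z\<bar> powr \<alpha>"
    by (rule locally_hoelderE[OF assms, of "{0..x + 1}"]) auto
  have "\<forall>\<^sub>F y in at x within {0..}. norm (F y - F x) \<le> C * \<bar>y - x\<bar> powr \<alpha>"
    unfolding eventually_at using x by (intro exI[of _ 1]) (auto simp: dist_real_def intro!: h)
  moreover have "((\<lambda>y. C * \<bar>y - x\<bar> powr \<alpha>) \<longlongrightarrow> 0) (at x within {0..})"
  proof -
    have "continuous_on UNIV (\<lambda>y. C * \<bar>y - x\<bar> powr \<alpha>)"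
      using \<open>0 < \<alpha>\<close> by (intro continuous_intros continuous_on_powr') auto
    then have "((\<lambda>y. C * \<bar>y - x\<bar> powr \<alpha>) \<longlongrightarrow> C * \<bar>x - x\<bar> powr \<alpha>) (at x)"
      unfolding continuous_on_def by blast
    then show ?thesis by (auto intro: tendsto_within_subset)
  qed
  ultimately have "((\<lambda>y. F y - F x) \<longlongrightarrow> 0) (at x within {0..})"
    by (rule Lim_null_comparison)
  then show "(F \<longlongrightarrow> F x) (at x within {0..})"
    by (simp add: LIM_zero_iff)
qed

lemma abs_exp_diff_le: "\<bar>exp a - exp b\<bar> \<le> exp (max a b) * \<bar>a - b\<bar>" for a b :: real
proof (induction a b rule: linorder_wlog)
  case (le a b)
  have "exp b * (1 + (a - b)) \<le> exp b * exp (a - b)"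
    by (intro mult_left_mono exp_ge_add_one_self) simp
  then have "exp b - exp a \<le> exp b * (b - a)"
    by (simp add: algebra_simps flip: exp_add)
  then show ?case using le by simp
qed (simp add: abs_minus_commute max.commute)

text \<open>
  Damping by an exponential preserves the hypothesis on \<open>F\<close>: the exponential is Lipschitz
  continuous on bounded sets, and there \<open>\<bar>x - y\<bar>\<close> is at most a multiple of \<open>\<bar>x - y\<bar> powr \<alpha>\<close>.
\<close>

lemma locally_hoelder_exp_scaleR:
  assumes "locally_hoelder F"
  shows "locally_hoelder (\<lambda>s. exp (b * s) *\<^sub>R F s)"
  unfolding locally_hoelder_def
proof (intro allI impI)
  fix K :: "real set" assume K: "compact K \<and> K \<subseteq> {0..}"
  then obtain A0 where A0: "A0 > 0" "\<forall>x\<in>K. norm x \<le> A0"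
    using compact_imp_bounded bounded_pos by meson
  define A where "A = A0 + 1"
  have A: "A > 1" "\<And>x. x \<in> K \<Longrightarrow> x \<le> A" using A0 by (force simp: A_def)+
  obtain \<alpha> C where \<alpha>: "0 < \<alpha>" "\<alpha> \<le> 1" "C > 0"
    and h: "\<And>y z. y \<in> {0..A} \<Longrightarrow> z \<in> {0..A} \<Longrightarrow> norm (F y - F z) \<le> C * \<bar>y - z\<bar> powr \<alpha>"
    by (rule locally_hoelderE[OF assms, of "{0..A}"]) auto
  define E where "E = exp (\<bar>b\<bar> * A)"
  have E: "exp (b * s) \<le> E" if "s \<in> {0..A}" for s
    using that abs_ge_self[of b] by (auto simp: E_def intro!: mult_mono)
  have "compact (F ` {0..A})"
    by (intro compact_continuous_image continuous_on_subset[OF locally_hoelder_imp_continuous_on[OF assms]]) auto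
  then obtain B where "B > 0" and B: "\<forall>y\<in>F ` {0..A}. norm y \<le> B"
    using compact_imp_bounded bounded_pos by meson
  show "\<exists>\<alpha> C. 0 < \<alpha> \<and> \<alpha> \<le> 1 \<and> C > 0 \<and>
      (\<forall>x\<in>K. \<forall>y\<in>K. norm (exp (b * x) *\<^sub>R F x - exp (b * y) *\<^sub>R F y) \<le> C * \<bar>x - y\<bar> powr \<alpha>)"
  proof (rule exI[of _ \<alpha>], rule exI[of _ "E * C + E * \<bar>b\<bar> * A * B"], intro conjI ballI)
    show "E * C + E * \<bar>b\<bar> * A * B > 0"
      using \<alpha> A \<open>B > 0\<close> by (intro add_pos_nonneg) (auto simp: E_def)
    fix x y assume "x \<in> K" "y \<in> K"
    with K A have xy: "x \<in> {0..A}" "y \<in> {0..A}" by auto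
    have lip: "\<bar>x - y\<bar> \<le> A * \<bar>x - y\<bar> powr \<alpha>"
    proof (cases "x = y")
      case False
      have "\<bar>x - y\<bar> powr (1 - \<alpha>) \<le> A powr (1 - \<alpha>)"
        using xy \<alpha> by (intro powr_mono2) auto
      also have "\<dots> \<le> A powr 1" using A \<alpha> by (intro powr_mono) auto
      finally have "\<bar>x - y\<bar> powr (1 - \<alpha>) * \<bar>x - y\<bar> powr \<alpha> \<le> A * \<bar>x - y\<bar> powr \<alpha>"
        using A by (intro mult_right_mono) auto
      then show ?thesis using False by (simp flip: powr_add)
    qed simp
    have "exp (b * x) *\<^sub>R F x - exp (b * y) *\<^sub>R F y
        = exp (b * x) *\<^sub>R (F x - F y) + (exp (b * x) - exp (b * y)) *\<^sub>R F y"
      by (simp add: algebra_simps)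
    also have "norm \<dots> \<le> exp (b * x) * norm (F x - F y) + \<bar>exp (b * x) - exp (b * y)\<bar> * norm (F y)"
      by (rule norm_triangle_le) simp
    also have "\<dots> \<le> E * (C * \<bar>x - y\<bar> powr \<alpha>) + (E * (\<bar>b\<bar> * (A * \<bar>x - y\<bar> powr \<alpha>))) * B"
    proof (intro add_mono mult_mono E h xy)
      have "\<bar>exp (b * x) - exp (b * y)\<bar> \<le> exp (max (b * x) (b * y)) * \<bar>b * x - b * y\<bar>"
        by (rule abs_exp_diff_le)
      also have "\<dots> \<le> E * (\<bar>b\<bar> * (A * \<bar>x - y\<bar> powr \<alpha>))"
      proof (intro mult_mono)
        show "exp (max (b * x) (b * y)) \<le> E"
          using E[OF xy(1)] E[OF xy(2)] by (simp add: max_def)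
        show "\<bar>b * x - b * y\<bar> \<le> \<bar>b\<bar> * (A * \<bar>x - y\<bar> powr \<alpha>)"
          using mult_left_mono[OF lip, of "\<bar>b\<bar>"] by (simp add: abs_mult flip: right_diff_distrib)
      qed (auto simp: E_def)
      finally show "\<bar>exp (b * x) - exp (b * y)\<bar> \<le> E * (\<bar>b\<bar> * (A * \<bar>x - y\<bar> powr \<alpha>))" .
      show "norm (F y) \<le> B" using B xy by simp
    qed (use A in \<open>auto simp: E_def\<close>)
    also have "\<dots> = (E * C + E * \<bar>b\<bar> * A * B) * \<bar>x - y\<bar> powr \<alpha>" by (simp add: algebra_simps)
    finally show "norm (exp (b * x) *\<^sub>R F x - exp (b * y) *\<^sub>R F y)
        \<le> (E * C + E * \<bar>b\<bar> * A * B) * \<bar>x - y\<bar> powr \<alpha>" .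
  qed (use \<alpha> in auto)
qed

section \<open>Uniform convergence of the Dirichlet integral\<close>

lemma integral_reflect_about:
  fixes f :: "real \<Rightarrow> 'a::real_normed_vector"
  shows "integral {t - b..t - a} (\<lambda>u. f (t - u)) = integral {a..b} f"
proof -
  have "integral {a..b} f = integral {-b..-a} (\<lambda>u. f (- u))" by simp
  also have "\<dots> = integral {-b - (- t)..-a - (- t)} (\<lambda>u. f (- (u + (- t))))"
    by (rule integral_shift_real_ivl[symmetric])
  finally show ?thesis by simp
qed

text \<open>
  Splitting the integral at \<open>s = t\<close> gives two one-sided integrals for the extension \<open>H\<close> of \<open>G\<close>
  by zero. The right half has length \<open>T - t\<close>, so the threshold for \<open>T\<close> depends on \<open>t\<close>; only the
  one for \<open>R\<close> has to be uniform, because \<open>T\<close> tends to infinity for fixed \<open>t\<close> and \<open>R\<close>.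
\<close>

lemma dirichlet_two_sided_uniform:
  fixes G :: "real \<Rightarrow> 'a::banach"
  assumes G: "locally_hoelder G" and G0: "G 0 = 0"
    and decay: "\<And>s. s \<ge> 0 \<Longrightarrow> norm (G s) \<le> C * exp (- c * s)" and c: "c > 0"
    and K: "compact K" "K \<subseteq> {0..}" and e: "e > 0"
  shows "\<forall>\<^sub>F R in at_top. \<forall>t\<in>K. \<forall>\<^sub>F T in at_top.
    norm (integral {0..T} (\<lambda>s. (R / pi * sinc (R * (t - s))) *\<^sub>R G s) - G t) \<le> e"
proof -
  obtain A where "A > 0" and A0: "\<forall>t\<in>K. norm t \<le> A"
    using compact_imp_bounded[OF K(1)] bounded_pos by meson
  have A: "0 \<le> t" "t \<le> A" if "t \<in> K" for t using A0 K that by force+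
  \<comment> \<open>As \<open>G 0 = 0\<close>, this is the continuous extension of \<open>G\<close> by \<open>0\<close>.\<close>
  define H where "H = (\<lambda>s. G (max 0 s))"
  have H_pos: "H s = G s" if "s \<ge> 0" for s using that by (simp add: H_def)
  have H_neg: "H s = 0" if "s \<le> 0" for s using that G0 by (simp add: H_def)
  have H_cont: "continuous_on S (\<lambda>x. H (g x))" if "continuous_on S g" for S :: "'c::topological_space set" and g
    unfolding H_def
    by (rule continuous_on_compose2[OF locally_hoelder_imp_continuous_on[OF G]]) (auto intro!: continuous_intros that)
  have C: "C \<ge> 0" using decay[of 0] norm_ge_zero[of "G 0"] by (simp del: norm_ge_zero)
  obtain \<alpha> L where \<alpha>: "0 < \<alpha>" and "L > 0"
    and L: "\<And>x y. x \<in> {0..A + 1} \<Longrightarrow> y \<in> {0..A + 1} \<Longrightarrow> norm (G x - G y) \<le> L * \<bar>x - y\<bar> powr \<alpha>"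
    by (rule locally_hoelderE[OF G, of "{0..A + 1}"]) auto
  have hoelder: "norm (H s - H t) \<le> L * x powr \<alpha>"
    if "t \<in> K" "0 \<le> x" "x \<le> 1" "\<bar>s - t\<bar> = x" for s t x
  proof -
    have "norm (H s - H t) \<le> L * \<bar>max 0 s - t\<bar> powr \<alpha>"
      using L[of "max 0 s" t] A[OF that(1)] that by (auto simp: H_def)
    also have "\<dots> \<le> L * x powr \<alpha>"
      using A[OF that(1)] that \<alpha> \<open>L > 0\<close> by (intro mult_left_mono powr_mono2) auto
    finally show ?thesis .
  qed
  have H_le: "norm (H s) \<le> C * exp (c * A) * exp (- c * x)" if t: "t \<in> K" and "0 \<le> x" "\<bar>s - t\<bar> = x" for s t x
  proof (cases "s \<ge> 0")
    case True
    have "c * (x - A) \<le> c * s"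
      using c A[OF t] that True by (intro mult_left_mono) auto
    then have "C * exp (- c * s) \<le> C * exp (c * A + - c * x)"
      using C by (intro mult_left_mono) (auto simp: algebra_simps)
    also have "\<dots> = C * exp (c * A) * exp (- c * x)" by (simp only: exp_add mult.assoc)
    finally show ?thesis using decay[OF True] H_pos[OF True] by simp
  qed (use C H_neg[of s] in auto)
  define e' where "e' = e * pi / 2"
  have e': "e' > 0" using e by (simp add: e'_def)
  have "\<exists>T0. \<forall>\<^sub>F R in at_top. \<forall>t\<in>K. \<forall>T\<ge>T0.
      norm (integral {0..T} (\<lambda>x. (R * sinc (R * x)) *\<^sub>R H (t + x)) - (pi / 2) *\<^sub>R H (t + 0)) \<le> e'"
  proof (rule dirichlet_one_sided_uniform[OF K(1), where H = "\<lambda>t x. H (t + x)"])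
    show "continuous_on (K \<times> {0..}) (\<lambda>(t, x). H (t + x))"
      unfolding case_prod_unfold by (intro H_cont continuous_intros)
    show "norm (H (t + x) - H (t + 0)) \<le> L * x powr \<alpha>" if "t \<in> K" "0 \<le> x" "x \<le> 1" for t x
      using hoelder[of t x "t + x"] that by simp
    show "norm (H (t + x)) \<le> C * exp (c * A) * exp (- c * x)" if "t \<in> K" "0 \<le> x" for t x
      using H_le[of t x "t + x"] that by simp
  qed (fact \<alpha> c e')+
  then obtain T1 where T1: "\<forall>\<^sub>F R in at_top. \<forall>t\<in>K. \<forall>T\<ge>T1.
      norm (integral {0..T} (\<lambda>x. (R * sinc (R * x)) *\<^sub>R H (t + x)) - (pi / 2) *\<^sub>R H (t + 0)) \<le> e'" ..
  have "\<exists>T0. \<forall>\<^sub>F R in at_top. \<forall>t\<in>K. \<forall>T\<ge>T0.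
      norm (integral {0..T} (\<lambda>x. (R * sinc (R * x)) *\<^sub>R H (t - x)) - (pi / 2) *\<^sub>R H (t - 0)) \<le> e'"
  proof (rule dirichlet_one_sided_uniform[OF K(1), where H = "\<lambda>t x. H (t - x)"])
    show "continuous_on (K \<times> {0..}) (\<lambda>(t, x). H (t - x))"
      unfolding case_prod_unfold by (intro H_cont continuous_intros)
    show "norm (H (t - x) - H (t - 0)) \<le> L * x powr \<alpha>" if "t \<in> K" "0 \<le> x" "x \<le> 1" for t x
      using hoelder[of t x "t - x"] that by simp
    show "norm (H (t - x)) \<le> C * exp (c * A) * exp (- c * x)" if "t \<in> K" "0 \<le> x" for t x
      using H_le[of t x "t - x"] that by simp
  qed (fact \<alpha> c e')+
  then obtain T2 where T2: "\<forall>\<^sub>F R in at_top. \<forall>t\<in>K. \<forall>T\<ge>T2.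
      norm (integral {0..T} (\<lambda>x. (R * sinc (R * x)) *\<^sub>R H (t - x)) - (pi / 2) *\<^sub>R H (t - 0)) \<le> e'" ..
  from T1 T2 show ?thesis
  proof eventually_elim
    case (elim R)
    show ?case
    proof
      fix t assume t: "t \<in> K"
      \<comment> \<open>The left half has length \<open>t\<close>, which may be below \<open>T2\<close>; integrating on to \<open>- S\<close> adds nothing, since \<open>H\<close> vanishes there.\<close>
      define S where "S = max 0 T2"
      show "\<forall>\<^sub>F T in at_top. norm (integral {0..T} (\<lambda>s. (R / pi * sinc (R * (t - s))) *\<^sub>R G s) - G t) \<le> e"
        using eventually_ge_at_top[of "t + max 0 T1"]
      proof eventually_elim
        case T: (elim T)
        define p where "p = (\<lambda>s. (R * sinc (R * (t - s))) *\<^sub>R H s)"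
        have p_int: "p integrable_on {a..b}" for a b
          unfolding p_def
          by (intro integrable_continuous_real continuous_on_scaleR H_cont continuous_intros)
        have e0: "integral {- S..0} p = 0"
          by (subst integral_cong[of _ _ "\<lambda>_. 0"]) (auto simp: p_def H_neg)
        have e1: "integral {- S..0} p + integral {0..T} p = integral {- S..T} p"
          using T A[OF t] by (intro Henstock_Kurzweil_Integration.integral_combine p_int) (auto simp: S_def)
        have e2: "integral {- S..t} p + integral {t..T} p = integral {- S..T} p"
          using T A[OF t] by (intro Henstock_Kurzweil_Integration.integral_combine p_int) (auto simp: S_def)
        have e3: "integral {- S..t} p = integral {0..t + S} (\<lambda>u. (R * sinc (R * u)) *\<^sub>R H (t - u))"
        proof -
          have "p (t - u) = (R * sinc (R * u)) *\<^sub>R H (t - u)" for u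
            by (simp add: p_def)
          then show ?thesis
            using integral_reflect_about[of t t "- S" p, symmetric] by simp
        qed
        have e4: "integral {t..T} p = integral {0..T - t} (\<lambda>u. (R * sinc (R * u)) *\<^sub>R H (t + u))"
        proof -
          have "p (u + t) = (R * sinc (R * u)) *\<^sub>R H (t + u)" for u
            using sinc_neg[of "R * u"] by (simp add: p_def add.commute)
          then show ?thesis
            using integral_shift_real_ivl[of t t T p, symmetric] by simp
        qed
        have "integral {0..T} p = integral {0..t + S} (\<lambda>u. (R * sinc (R * u)) *\<^sub>R H (t - u))
            + integral {0..T - t} (\<lambda>u. (R * sinc (R * u)) *\<^sub>R H (t + u))"
          using e1 e2 unfolding e0 e3 e4 by (simp only: add_0_left)
        moreover have "pi *\<^sub>R H t = (pi / 2) *\<^sub>R H (t - 0) + (pi / 2) *\<^sub>R H (t + 0)"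
          by (simp flip: scaleR_add_left)
        ultimately have "integral {0..T} p - pi *\<^sub>R H t =
            (integral {0..t + S} (\<lambda>u. (R * sinc (R * u)) *\<^sub>R H (t - u)) - (pi / 2) *\<^sub>R H (t - 0))
            + (integral {0..T - t} (\<lambda>u. (R * sinc (R * u)) *\<^sub>R H (t + u)) - (pi / 2) *\<^sub>R H (t + 0))"
          by (simp only: add_diff_add)
        also have "norm \<dots> \<le> e' + e'"
        proof (rule norm_triangle_mono)
          have "t + S \<ge> T2" using A[OF t] by (simp add: S_def)
          then show "norm (integral {0..t + S} (\<lambda>u. (R * sinc (R * u)) *\<^sub>R H (t - u)) - (pi / 2) *\<^sub>R H (t - 0)) \<le> e'"
            using elim(2) t by blast
          have "T - t \<ge> T1" using T by simp
          then show "norm (integral {0..T - t} (\<lambda>u. (R * sinc (R * u)) *\<^sub>R H (t + u)) - (pi / 2) *\<^sub>R H (t + 0)) \<le> e'"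
            using elim(1) t by blast
        qed
        finally have main: "norm (integral {0..T} p - pi *\<^sub>R H t) \<le> e * pi"
          by (simp add: e'_def mult.commute)
        have "integral {0..T} (\<lambda>s. (R / pi * sinc (R * (t - s))) *\<^sub>R G s) = integral {0..T} (\<lambda>s. (1 / pi) *\<^sub>R p s)"
          by (rule integral_cong) (simp add: p_def H_pos)
        also have "\<dots> = (1 / pi) *\<^sub>R integral {0..T} p" by (rule integral_cmul)
        finally have "integral {0..T} (\<lambda>s. (R / pi * sinc (R * (t - s))) *\<^sub>R G s) - G t
            = (1 / pi) *\<^sub>R (integral {0..T} p - pi *\<^sub>R H t)"
          using A[OF t] by (simp only: scaleR_diff_right H_pos) simp
        then have "norm (integral {0..T} (\<lambda>s. (R / pi * sinc (R * (t - s))) *\<^sub>R G s) - G t)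
            = norm (integral {0..T} p - pi *\<^sub>R H t) / pi"
          by (simp only: norm_scaleR) simp
        then show ?case using main by (simp only: pos_divide_le_eq pi_gt_zero)
      qed
    qed
  qed
qed

section \<open>The inversion integral as a Dirichlet integral\<close>

lemma bounded_bilinear_scaleC:
  "bounded_bilinear (scaleC :: complex \<Rightarrow> 'a::complex_banach \<Rightarrow> 'a)"
proof
  fix r :: real and a :: complex and x :: 'a
  show "(r *\<^sub>R a) *\<^sub>C x = r *\<^sub>R (a *\<^sub>C x)"
    by (simp add: scaleR_conv_of_real flip: scaleC_scaleC scaleC_of_real)
  show "a *\<^sub>C (r *\<^sub>R x) = r *\<^sub>R (a *\<^sub>C x)"
    by (simp add: scaleC_scaleC mult.commute flip: scaleC_of_real)
  show "\<exists>K. \<forall>(a::complex) (x::'a). norm (a *\<^sub>C x) \<le> norm a * norm x * K"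
    by (intro exI[of _ 1]) (simp add: norm_scaleC)
qed (simp_all add: scaleC_add_left scaleC_add_right)

lemmas continuous_on_scaleC = bounded_bilinear.continuous_on[OF bounded_bilinear_scaleC]
lemmas bounded_linear_scaleC_right = bounded_bilinear.bounded_linear_right[OF bounded_bilinear_scaleC]
lemmas bounded_linear_scaleC_left = bounded_bilinear.bounded_linear_left[OF bounded_bilinear_scaleC]
lemmas scaleC_diff_right = bounded_bilinear.diff_right[OF bounded_bilinear_scaleC]

text \<open>
  The error depends on \<open>z\<close> only through its real part, which is what makes the truncation
  uniform along the segment of integration.
\<close>

lemma laplace_transform_truncation:
  fixes F :: "real \<Rightarrow> 'a::complex_banach"
  assumes F: "continuous_on {0..} F" and bound: "\<And>t. t \<ge> 0 \<Longrightarrow> norm (F t) \<le> C * exp (\<omega>\<^sub>0 * t)"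
    and z: "Re z > \<omega>\<^sub>0" and T: "T \<ge> 0"
  shows "norm (integral {0..T} (\<lambda>s. exp (- z * complex_of_real s) *\<^sub>C F s) - laplace_transform F z)
    \<le> C / (Re z - \<omega>\<^sub>0) * exp (- (Re z - \<omega>\<^sub>0) * T)"
proof -
  define g where "g = (\<lambda>s. exp (- z * complex_of_real s) *\<^sub>C F s)"
  define c where "c = Re z - \<omega>\<^sub>0"
  have c: "c > 0" using z by (simp add: c_def)
  have g: "continuous_on {0..} g"
    unfolding g_def by (intro continuous_on_scaleC F continuous_intros)
  have g_le: "norm (g s) \<le> C * exp (- c * s)" if "s \<ge> 0" for s
  proof -
    have "norm (g s) \<le> exp (- Re z * s) * (C * exp (\<omega>\<^sub>0 * s))"
      unfolding g_def norm_scaleC using bound[OF that] by (simp add: norm_exp_eq_Re)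
    also have "\<dots> = C * exp (- c * s)"
      by (simp add: c_def algebra_simps flip: exp_add)
    finally show ?thesis .
  qed
  obtain I where I: "\<And>T. T \<ge> 0 \<Longrightarrow> norm (integral {0..T} g - I) \<le> C / c * exp (- c * T)"
    using exp_decay_improper_integral[OF g c g_le] by blast
  have "(\<lambda>n. C / c * exp (- c * real n)) \<longlonglongrightarrow> 0"
    using c by real_asymp
  then have "(\<lambda>n. integral {0..real n} g - I) \<longlonglongrightarrow> 0"
    by (rule Lim_null_comparison[rotated]) (use I in auto)
  then have "(\<lambda>n. integral {0..real n} g) \<longlonglongrightarrow> I" by (simp add: LIM_zero_iff)
  from has_bochner_integral_ns_exp_decay[OF g c g_le this]
  have "laplace_transform F z = I"
    unfolding laplace_transform_def g_def by (rule bochner_integral_ns_eqI)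
  then show ?thesis using I[OF T] by (simp add: g_def c_def)
qed

text \<open>
  The parameter \<open>x\<close> runs through \<open>{0..1}\<close>, so this is the mean of \<open>exp (z * u)\<close> over the segment;
  it is the source of the Dirichlet kernel.
\<close>

lemma has_integral_exp_vertical_segment:
  assumes R: "R > 0"
  shows "((\<lambda>x. exp (linepath (Complex \<omega> (- R)) (Complex \<omega> R) x * complex_of_real u)) has_integral
    complex_of_real (exp (\<omega> * u) * sinc (R * u))) {0..1}"
proof (cases "u = 0")
  case True
  then show ?thesis using has_integral_const_real[of "1::complex" 0 1] by simp
next
  case False
  let ?z = "linepath (Complex \<omega> (- R)) (Complex \<omega> R)"
  define w where "w = 2 * \<i> * complex_of_real (R * u)"
  have w: "w \<noteq> 0" using R False by (simp add: w_def)
  have z: "?z x * complex_of_real u = complex_of_real (\<omega> * u) - \<i> * complex_of_real (R * u) + w * complex_of_real x" for x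
    by (simp add: linepath_def w_def complex_eq_iff algebra_simps)
  have "((\<lambda>x. exp (?z x * complex_of_real u)) has_integral
      exp (?z 1 * complex_of_real u) / w - exp (?z 0 * complex_of_real u) / w) {0..1}"
  proof (rule fundamental_theorem_of_calculus)
    fix x :: real
    show "((\<lambda>x. exp (?z x * complex_of_real u) / w) has_vector_derivative
        exp (?z x * complex_of_real u)) (at x within {0..1})"
      unfolding z using w
      by (auto intro!: derivative_eq_intros has_vector_derivative_real_field simp: field_simps)
  qed simp
  moreover have "exp (?z 1 * complex_of_real u) / w - exp (?z 0 * complex_of_real u) / w
      = complex_of_real (exp (\<omega> * u) * sinc (R * u))"
  proof -
    have "exp (?z 1 * complex_of_real u) - exp (?z 0 * complex_of_real u)
        = exp (complex_of_real (\<omega> * u)) * (exp (\<i> * complex_of_real (R * u)) - exp (- (\<i> * complex_of_real (R * u))))"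
      unfolding z w_def by (simp add: right_diff_distrib add.commute flip: exp_add)
    also have "\<dots> = complex_of_real (exp (\<omega> * u)) * (2 * \<i> * complex_of_real (sin (R * u)))"
      unfolding exp_of_real sin_of_real[symmetric] sin_exp_eq by (simp add: field_simps)
    also have "\<dots> = w * complex_of_real (exp (\<omega> * u) * sinc (R * u))"
      using R False by (simp add: w_def)
    finally show ?thesis using w by (simp add: field_simps flip: diff_divide_distrib)
  qed
  ultimately show ?thesis by simp
qed

text \<open>
  Truncating the Laplace integral at \<open>T\<close> perturbs the integrand on the segment uniformly, so
  the integrals over the segment converge as \<open>T \<rightarrow> \<infinity>\<close>. For fixed \<open>T\<close> both integrals range over
  compact intervals and may be exchanged.
\<close>

lemma inversion_integral_eq_dirichlet_limit:
  fixes F :: "real \<Rightarrow> 'a::complex_banach"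
  assumes F: "continuous_on {0..} F" and bound: "\<And>t. t \<ge> 0 \<Longrightarrow> norm (F t) \<le> C * exp (\<omega>\<^sub>0 * t)"
    and \<omega>: "\<omega> > \<omega>\<^sub>0" and R: "R > 0"
  shows "((\<lambda>T. integral {0..T} (\<lambda>s. (R / pi * (exp (\<omega> * (t - s)) * sinc (R * (t - s)))) *\<^sub>R F s)) \<longlongrightarrow>
    (1 / (2 * complex_of_real pi * \<i>)) *\<^sub>C segment_integral (Complex \<omega> (- R)) (Complex \<omega> R)
       (\<lambda>z. exp (z * complex_of_real t) *\<^sub>C laplace_transform F z)) at_top"
proof -
  let ?z = "linepath (Complex \<omega> (- R)) (Complex \<omega> R)"
  define v where "v = Complex \<omega> R - Complex \<omega> (- R)"
  have v: "v = 2 * \<i> * complex_of_real R" by (simp add: v_def complex_eq_iff)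
  have Re_z: "Re (?z x) = \<omega>" for x
    by (simp add: linepath_def algebra_simps)
  define q where "q = (\<lambda>x. v *\<^sub>C (exp (?z x * complex_of_real t) *\<^sub>C laplace_transform F (?z x)))"
  define f where "f = (\<lambda>x s. (v * exp (?z x * complex_of_real (t - s))) *\<^sub>C F s)"
  define \<Phi> where "\<Phi> = (\<lambda>T x. integral {0..T} (f x))"
  have F': "continuous_on S (\<lambda>p. F (g p))" if "continuous_on S g" "g ` S \<subseteq> {0..}" for S :: "(real \<times> real) set" and g
    using continuous_on_compose2[OF F that] .
  have f_cont: "continuous_on (cbox (0, 0) (1, T)) (\<lambda>(x, s). f x s)" for T
    unfolding f_def case_prod_unfold linepath_def
    by (intro continuous_on_scaleC F' continuous_intros) (auto simp: cbox_Pair_eq)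
  have \<Phi>_cont: "continuous_on {0..1} (\<Phi> T)" for T
    using integral_continuous_on_param[of "{0..1}" 0 T f] f_cont[of T]
    unfolding \<Phi>_def by (simp add: cbox_Pair_eq)
  define c where "c = \<omega> - \<omega>\<^sub>0"
  have c: "c > 0" using \<omega> by (simp add: c_def)
  have err: "norm (\<Phi> T x - q x) \<le> 2 * R * exp (\<omega> * t) * (C / c * exp (- c * T))"
    if T: "T \<ge> 0" for T x
  proof -
    let ?g = "\<lambda>s. exp (- ?z x * complex_of_real s) *\<^sub>C F s"
    have "?g integrable_on {0..T}"
      by (intro integrable_continuous_real continuous_on_scaleC continuous_intros continuous_on_subset[OF F]) auto
    then have "integral {0..T} ((\<lambda>y. (v * exp (?z x * complex_of_real t)) *\<^sub>C y) \<circ> ?g)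
        = (v * exp (?z x * complex_of_real t)) *\<^sub>C integral {0..T} ?g"
      by (rule integral_linear[OF _ bounded_linear_scaleC_right])
    moreover have "(\<lambda>y. (v * exp (?z x * complex_of_real t)) *\<^sub>C y) \<circ> ?g = f x"
      by (auto simp: f_def scaleC_scaleC algebra_simps simp flip: exp_add exp_diff)
    ultimately have "\<Phi> T x - q x = (v * exp (?z x * complex_of_real t)) *\<^sub>C
        (integral {0..T} ?g - laplace_transform F (?z x))"
      by (simp add: \<Phi>_def q_def scaleC_scaleC scaleC_diff_right)
    also have "norm \<dots> = 2 * R * exp (\<omega> * t) * norm (integral {0..T} ?g - laplace_transform F (?z x))"
      using R Re_z[of x] by (simp add: norm_scaleC norm_mult v norm_exp_eq_Re)
    also have "\<dots> \<le> 2 * R * exp (\<omega> * t) * (C / c * exp (- c * T))"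
      using laplace_transform_truncation[OF F bound, of "?z x" T] T \<omega> R
      by (intro mult_left_mono) (auto simp: Re_z c_def)
    finally show ?thesis .
  qed
  have "uniform_limit {0..1} \<Phi> q at_top"
  proof (rule uniform_limitI)
    fix e :: real assume e: "e > 0"
    have "((\<lambda>T. 2 * R * exp (\<omega> * t) * (C / c * exp (- c * T))) \<longlongrightarrow> 0) at_top"
      using c by real_asymp
    then have "\<forall>\<^sub>F T in at_top. 2 * R * exp (\<omega> * t) * (C / c * exp (- c * T)) < e"
      using e by (rule order_tendstoD)
    then show "\<forall>\<^sub>F T in at_top. \<forall>x\<in>{0..1}. dist (\<Phi> T x) (q x) < e"
      using eventually_ge_at_top[of 0]
      by eventually_elim (auto simp: dist_norm intro: order_le_less_trans[OF err])
  qed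
  then obtain I J where I: "\<And>T. (\<Phi> T has_integral I T) {0..1}" and J: "(q has_integral J) {0..1}"
    and lim: "(I \<longlongrightarrow> J) at_top"
    by (rule uniform_limit_integral[OF _ \<Phi>_cont]) auto
  have I_eq: "(1 / (2 * complex_of_real pi * \<i>)) *\<^sub>C I T
      = integral {0..T} (\<lambda>s. (R / pi * (exp (\<omega> * (t - s)) * sinc (R * (t - s)))) *\<^sub>R F s)" for T
  proof -
    have "I T = integral {0..1} (\<lambda>x. integral {0..T} (f x))"
      using I[of T] by (simp add: \<Phi>_def has_integral_iff)
    also have "\<dots> = integral {0..T} (\<lambda>s. integral {0..1} (\<lambda>x. f x s))"
      using integral_swap_continuous[OF f_cont[of T]] by simp
    finally have IT: "I T = integral {0..T} (\<lambda>s. integral {0..1} (\<lambda>x. f x s))" .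
    have inner: "integral {0..1} (\<lambda>x. f x s)
        = (v * complex_of_real (exp (\<omega> * (t - s)) * sinc (R * (t - s)))) *\<^sub>C F s" for s
    proof -
      have "((\<lambda>x. v * exp (?z x * complex_of_real (t - s))) has_integral
          v * complex_of_real (exp (\<omega> * (t - s)) * sinc (R * (t - s)))) {0..1}"
        by (intro has_integral_mult_right has_integral_exp_vertical_segment R)
      from has_integral_linear[OF this bounded_linear_scaleC_left[of "F s"]]
      show ?thesis unfolding f_def o_def by (rule integral_unique)
    qed
    have F_sub: "continuous_on {0..T} F" by (rule continuous_on_subset[OF F]) auto
    have "(\<lambda>s. (v * complex_of_real (exp (\<omega> * (t - s)) * sinc (R * (t - s)))) *\<^sub>C F s) integrable_on {0..T}"
      by (intro integrable_continuous_real continuous_on_scaleC F_sub continuous_on_mult continuous_on_of_real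
          continuous_on_const continuous_on_sinc continuous_on_exp continuous_on_diff continuous_on_id)
    from integral_linear[OF this bounded_linear_scaleC_right[of "1 / (2 * complex_of_real pi * \<i>)"]]
    have "(1 / (2 * complex_of_real pi * \<i>)) *\<^sub>C I T = integral {0..T} (\<lambda>s. (1 / (2 * complex_of_real pi * \<i>)) *\<^sub>C
        ((v * complex_of_real (exp (\<omega> * (t - s)) * sinc (R * (t - s)))) *\<^sub>C F s))"
      unfolding IT inner o_def by simp
    also have "\<dots> = integral {0..T} (\<lambda>s. (R / pi * (exp (\<omega> * (t - s)) * sinc (R * (t - s)))) *\<^sub>R F s)"
    proof (rule integral_cong)
      fix s
      have "(1 / (2 * complex_of_real pi * \<i>)) * (v * complex_of_real y) = complex_of_real (R / pi * y)" for y
        by (simp add: v)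
      then show "(1 / (2 * complex_of_real pi * \<i>)) *\<^sub>C
          ((v * complex_of_real (exp (\<omega> * (t - s)) * sinc (R * (t - s)))) *\<^sub>C F s)
          = (R / pi * (exp (\<omega> * (t - s)) * sinc (R * (t - s)))) *\<^sub>R F s"
        by (simp only: scaleC_scaleC scaleC_of_real)
    qed
    finally show ?thesis .
  qed
  have "segment_integral (Complex \<omega> (- R)) (Complex \<omega> R)
       (\<lambda>z. exp (z * complex_of_real t) *\<^sub>C laplace_transform F z) = J"
    using J by (simp add: segment_integral_def q_def v_def has_integral_iff)
  then show ?thesis
    using bounded_linear.tendsto[OF bounded_linear_scaleC_right lim, of "1 / (2 * complex_of_real pi * \<i>)"]
    by (simp only: I_eq)
qed

section \<open>Complex inversion of the Laplace transform\<close>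

theorem proposition1p1:
  fixes F :: "real \<Rightarrow> 'a::complex_banach" and \<omega>\<^sub>0 \<omega> :: real
  assumes "locally_hoelder F"
    and "F 0 = 0"
    and "exponential_growth_bound F \<omega>\<^sub>0"
    and "\<omega> > \<omega>\<^sub>0"
  shows "\<forall>K. compact K \<and> K \<subseteq> {0..} \<longrightarrow>
    uniform_limit K
      (\<lambda>R t. (1 / (2 * complex_of_real pi * \<i>)) *\<^sub>C
         segment_integral (Complex \<omega> (- R)) (Complex \<omega> R)
           (\<lambda>z. exp (z * complex_of_real t) *\<^sub>C laplace_transform F z))
      F at_top"
proof (intro allI impI uniform_limitI)
  fix K :: "real set" and e :: real
  assume K: "compact K \<and> K \<subseteq> {0..}" and e: "e > 0"
  define P where "P = (\<lambda>R t. (1 / (2 * complex_of_real pi * \<i>)) *\<^sub>C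
         segment_integral (Complex \<omega> (- R)) (Complex \<omega> R)
           (\<lambda>z. exp (z * complex_of_real t) *\<^sub>C laplace_transform F z))"
  define G where "G = (\<lambda>s. exp (- \<omega> * s) *\<^sub>R F s)"
  have F_eq: "F s = exp (\<omega> * s) *\<^sub>R G s" for s
    by (simp add: G_def flip: exp_add)
  obtain C where bound: "\<And>t. t \<ge> 0 \<Longrightarrow> norm (F t) \<le> C * exp (\<omega>\<^sub>0 * t)"
    using assms(3) unfolding exponential_growth_bound_def by blast
  have decay: "norm (G s) \<le> C * exp (- (\<omega> - \<omega>\<^sub>0) * s)" if "s \<ge> 0" for s
  proof -
    have "norm (G s) \<le> exp (- \<omega> * s) * (C * exp (\<omega>\<^sub>0 * s))"
      using bound[OF that] by (simp add: G_def)
    also have "\<dots> = C * exp (- (\<omega> - \<omega>\<^sub>0) * s)"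
      by (simp add: algebra_simps flip: exp_add)
    finally show ?thesis .
  qed
  obtain A where "A > 0" and A: "\<forall>t\<in>K. norm t \<le> A"
    using K compact_imp_bounded bounded_pos by meson
  define M where "M = exp (\<bar>\<omega>\<bar> * A)"
  have M: "exp (\<omega> * t) \<le> M" if "t \<in> K" for t
  proof -
    have "\<omega> * t \<le> \<bar>\<omega>\<bar> * \<bar>t\<bar>" by (metis abs_ge_self abs_mult)
    also have "\<dots> \<le> \<bar>\<omega>\<bar> * A" using A that by (intro mult_left_mono) auto
    finally show ?thesis by (simp add: M_def)
  qed
  define e' where "e' = e / (2 * M)"
  have e': "e' > 0" "M > 0" using e by (auto simp: e'_def M_def)
  have "\<forall>\<^sub>F R in at_top. \<forall>t\<in>K. \<forall>\<^sub>F T in at_top.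
      norm (integral {0..T} (\<lambda>s. (R / pi * sinc (R * (t - s))) *\<^sub>R G s) - G t) \<le> e'"
  proof (rule dirichlet_two_sided_uniform[OF _ _ decay])
    show "locally_hoelder G" unfolding G_def by (rule locally_hoelder_exp_scaleR) fact
  qed (use assms K e' in \<open>auto simp: G_def\<close>)
  then have "\<forall>\<^sub>F R in at_top. \<forall>t\<in>K. dist (P R t) (F t) < e"
    using eventually_gt_at_top[of 0]
  proof eventually_elim
    case (elim R)
    show ?case
    proof
      fix t assume t: "t \<in> K"
      \<comment> \<open>\<open>D T\<close> is the inversion integral with the Laplace transform truncated at \<open>T\<close>.\<close>
      define D where "D = (\<lambda>T. integral {0..T} (\<lambda>s. (R / pi * (exp (\<omega> * (t - s)) * sinc (R * (t - s)))) *\<^sub>R F s))"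
      have D_eq: "D T = exp (\<omega> * t) *\<^sub>R integral {0..T} (\<lambda>s. (R / pi * sinc (R * (t - s))) *\<^sub>R G s)" for T
      proof -
        have "D T = integral {0..T} (\<lambda>s. exp (\<omega> * t) *\<^sub>R ((R / pi * sinc (R * (t - s))) *\<^sub>R G s))"
          unfolding D_def
        proof (rule integral_cong)
          fix s
          have "exp (\<omega> * (t - s)) = exp (\<omega> * t) * exp (- \<omega> * s)"
            by (simp add: right_diff_distrib flip: exp_add)
          then show "(R / pi * (exp (\<omega> * (t - s)) * sinc (R * (t - s)))) *\<^sub>R F s
              = exp (\<omega> * t) *\<^sub>R ((R / pi * sinc (R * (t - s))) *\<^sub>R G s)"
            unfolding G_def scaleR_scaleR by (simp only: mult_ac)
        qed
        then show ?thesis by (simp only: integral_cmul)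
      qed
      have "(D \<longlongrightarrow> P R t) at_top"
        unfolding D_def P_def
        by (rule inversion_integral_eq_dirichlet_limit[OF locally_hoelder_imp_continuous_on[OF assms(1)] bound assms(4) elim(2)])
      then have "((\<lambda>T. norm (D T - F t)) \<longlongrightarrow> norm (P R t - F t)) at_top"
        by (intro tendsto_intros)
      moreover have "\<forall>\<^sub>F T in at_top. norm (D T - F t) \<le> M * e'"
        using elim(1)[rule_format, OF t]
      proof eventually_elim
        case (elim T)
        have "norm (D T - F t) = exp (\<omega> * t) * norm (integral {0..T} (\<lambda>s. (R / pi * sinc (R * (t - s))) *\<^sub>R G s) - G t)"
          unfolding D_eq F_eq[of t] scaleR_diff_right[symmetric] norm_scaleR by simp
        also have "\<dots> \<le> M * e'" using elim M[OF t] e' by (intro mult_mono) auto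
        finally show ?case .
      qed
      ultimately have "norm (P R t - F t) \<le> M * e'"
        by (rule tendsto_upperbound) simp
      also have "M * e' < e" using e e' by (simp add: e'_def)
      finally show "dist (P R t) (F t) < e" by (simp add: dist_norm)
    qed
  qed
  then show "\<forall>\<^sub>F R in at_top. \<forall>t\<in>K. dist ((1 / (2 * complex_of_real pi * \<i>)) *\<^sub>C
         segment_integral (Complex \<omega> (- R)) (Complex \<omega> R)
           (\<lambda>z. exp (z * complex_of_real t) *\<^sub>C laplace_transform F z)) (F t) < e"
    by (simp only: P_def)
qed

end
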